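(* Let $d\ge 1$ and $k$ be integers with $k>d/2$, and let $\mathcal{B}^d=\{x\in\mathbb{R}^d : |x|\le 1\}$. Let $f\in \mathbf{C}(\mathcal{B}^d)$. Given $\epsilon>0$ there is a finite subset $Y\subset \mathcal{B}^d$ and a set of real coefficients $\{\alpha_y : y\in Y\}$ such that $$\left|f(x)-\sum_{y\in Y}\alpha_y\,\phi_{d,k}(|x-y|)\right|\le \epsilon$$ for all $x\in\mathcal{B}^d$.
   Context: $|\cdot|$ is the Euclidean norm on $\mathbb{R}^d$ and $\mathbf{C}(\Omega)$ is the space of real-valued continuous functions on a compact set $\Omega\subset\mathbb{R}^d$. The polyharmonic spline $\phi_{d,k}:[0,\infty)\to\mathbb{R}$ (for integers $d\ge1$, $k>d/2$) is $\phi_{d,k}(r)=r^{2k-d}$ if $d$ is odd, and $\phi_{d,k}(r)=r^{2k-d}\log r$ if $d$ is even (with value $0$ at $r=0$). *)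

theory Defs
  imports "HOL-Analysis.Analysis"
begin

text \<open>
  The exponent is a truncated subtraction on naturals, and the definition is meant for
  \<open>d < 2 * k\<close> only. There the exponent is positive, so the value at \<open>r = 0\<close>
  is \<open>0\<close> in both cases, whatever the value of \<open>ln 0\<close>.
\<close>

definition polyharmonic_spline :: "nat \<Rightarrow> nat \<Rightarrow> real \<Rightarrow> real" where
  "polyharmonic_spline d k r =
     (if odd d then r ^ (2 * k - d) else r ^ (2 * k - d) * ln r)"

end

theory Submission
  imports Defs "HOL-Computational_Algebra.Polynomial"
begin

text \<open>
  Let \<open>\<phi>\<close> be the polyharmonic spline and \<open>V\<close> the closed span, in the uniform norm on the unit
  ball, of the functions \<open>x \<mapsto> \<phi> (|x - y|)\<close> with \<open>y\<close> in the ball. The claim is that \<open>V\<close> contains every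
  continuous function. This is not a mere density statement on compact subsets of the interior:
  approximants with centres slightly outside the ball would be easy to get, but the centres
  are confined to the ball on which the approximation takes place. Interior and boundary are
  therefore treated by different means.

  \<^emph>\<open>Interior.\<close> Up to a nonzero constant, \<open>\<phi>\<close> is the fundamental solution of the iterated Laplacian:
  if \<open>f\<close> is smooth enough and vanishes outside the ball, then \<open>\<integral> \<phi> (|x - y|) (\<Delta>\<^sup>k f) y dy = C f x\<close>
  with \<open>C \<noteq> 0\<close> (\<open>polyharmonic_representation\<close>). The integral only involves centres in the ball and is a
  uniform limit of finite sums, so \<open>f\<close> lies in \<open>V\<close>. Applied to \<open>(1 - |x|\<^sup>2)\<^sub>+\<^sup>m p(x)\<close> with polynomial \<open>p\<close>,
  together with the Weierstrass theorem, this gives all continuous functions that vanish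
  near the sphere (\<open>kernel_approx_vanishing_near_sphere\<close>).

  The fundamental solution property is proved by regularization. Write \<open>\<phi>(r) = \<psi>(r\<^sup>2)\<close>, where
  \<open>\<psi>(q)\<close> is \<open>q\<^sup>s\<close> or \<open>(1/2) q\<^sup>s ln q\<close> with \<open>s = k - d/2\<close>. The function \<open>\<psi>(|x|\<^sup>2 + \<epsilon>\<^sup>2)\<close> is smooth, and its
  \<open>k\<close>-fold Laplacian collapses to the single term \<open>\<kappa> \<epsilon>\<^sup>2\<^sup>k (|x|\<^sup>2 + \<epsilon>\<^sup>2)\<^sup>s\<^sup>-\<^sup>2\<^sup>k\<close> with \<open>\<kappa> \<noteq> 0\<close>
  (\<open>laplace_profile_top\<close>). This has constant sign, is integrable because \<open>2k - s = k + d/2 > d\<close>,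
  and by scaling it is an approximate identity as \<open>\<epsilon> \<rightarrow> 0\<close>, so that integration by parts gives the claim.

  \<^emph>\<open>Boundary.\<close> For \<open>|x| = |v| = 1\<close> the function \<open>\<psi>(|x - t v|\<^sup>2) = \<psi>(1 - 2 t (x \<bullet> v) + t\<^sup>2)\<close> is smooth in
  \<open>t \<in> (-1, 1)\<close>, and its \<open>t\<close>-derivatives are uniform limits of difference quotients, hence they are
  approximable on the sphere as well. At \<open>t = 0\<close> the \<open>n\<close>-th derivative is a polynomial in \<open>x \<bullet> v\<close>
  with leading term \<open>(-2)\<^sup>n \<psi>\<^sup>(\<^sup>n\<^sup>)(1) (x \<bullet> v)\<^sup>n\<close>, so by induction all powers of \<open>x \<bullet> v\<close> are approximable, then
  \<open>exp (x \<bullet> v)\<close> for all \<open>v\<close>, and then every continuous function on the sphere by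
  Stone-Weierstrass (\<open>kernel_approx_sphere\<close>).

  \<^emph>\<open>Conclusion.\<close> Given \<open>f\<close>, choose a combination \<open>S\<close> of kernel translates that is close to \<open>f\<close> on the sphere.
  Then \<open>f - S\<close> is uniformly close to a function that vanishes near the sphere, and
  the interior result applies to that function.
\<close>

section \<open>Uniform approximation by combinations of kernel translates\<close>

text \<open>
  Membership in the closed span of the functions \<open>K \<cdot> y\<close>, \<open>y \<in> B\<close>, for uniform convergence on \<open>X\<close>.
  The sets \<open>X\<close> and \<open>B\<close> are separate because the sphere is treated with centres in the whole ball.
\<close>
definition kernel_approx ::
  "('a \<Rightarrow> 'b \<Rightarrow> real) \<Rightarrow> 'b set \<Rightarrow> 'a set \<Rightarrow> ('a \<Rightarrow> real) \<Rightarrow> bool" where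
  "kernel_approx K B X f \<longleftrightarrow>
     (\<forall>\<epsilon>>0. \<exists>Y \<alpha>. finite Y \<and> Y \<subseteq> B \<and> (\<forall>x\<in>X. \<bar>f x - (\<Sum>y\<in>Y. \<alpha> y * K x y)\<bar> \<le> \<epsilon>))"

lemma kernel_approxI:
  assumes "finite Y" "Y \<subseteq> B" "\<And>x. x \<in> X \<Longrightarrow> f x = (\<Sum>y\<in>Y. \<alpha> y * K x y)"
  shows "kernel_approx K B X f"
  unfolding kernel_approx_def using assms by (intro allI impI exI[of _ Y] exI[of _ \<alpha>]) auto

lemma kernel_approxE:
  assumes "kernel_approx K B X f" "\<epsilon> > 0"
  obtains Y \<alpha> where "finite Y" "Y \<subseteq> B"
    "\<And>x. x \<in> X \<Longrightarrow> \<bar>f x - (\<Sum>y\<in>Y. \<alpha> y * K x y)\<bar> \<le> \<epsilon>"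
proof -
  from assms(1)[unfolded kernel_approx_def, rule_format, OF assms(2)] obtain Y \<alpha>
    where "finite Y \<and> Y \<subseteq> B \<and> (\<forall>x\<in>X. \<bar>f x - (\<Sum>y\<in>Y. \<alpha> y * K x y)\<bar> \<le> \<epsilon>)"
    by (elim exE)
  then show thesis by (intro that[of Y \<alpha>]) auto
qed

lemma kernel_approx_kernel: "y \<in> B \<Longrightarrow> kernel_approx K B X (\<lambda>x. K x y)"
  by (rule kernel_approxI[of "{y}" _ _ _ "\<lambda>_. 1"]) auto

lemma kernel_approx_zero: "kernel_approx K B X (\<lambda>x. 0)"
  by (rule kernel_approxI[of "{}"]) auto

lemma kernel_approx_cong:
  "kernel_approx K B X f \<Longrightarrow> (\<And>x. x \<in> X \<Longrightarrow> f x = g x) \<Longrightarrow> kernel_approx K B X g"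
  unfolding kernel_approx_def by simp

lemma kernel_approx_add:
  assumes "kernel_approx K B X f" "kernel_approx K B X g"
  shows "kernel_approx K B X (\<lambda>x. f x + g x)"
  unfolding kernel_approx_def
proof (intro allI impI)
  fix e :: real assume "e > 0"
  then have e2: "e / 2 > 0" by simp
  obtain Y a where Y: "finite Y" "Y \<subseteq> B" "\<And>x. x \<in> X \<Longrightarrow> \<bar>f x - (\<Sum>y\<in>Y. a y * K x y)\<bar> \<le> e / 2"
    by (rule kernel_approxE[OF assms(1) e2]) blast
  obtain Z b where Z: "finite Z" "Z \<subseteq> B" "\<And>x. x \<in> X \<Longrightarrow> \<bar>g x - (\<Sum>y\<in>Z. b y * K x y)\<bar> \<le> e / 2"
    by (rule kernel_approxE[OF assms(2) e2]) blast
  define c where "c y = (if y \<in> Y then a y else 0) + (if y \<in> Z then b y else 0)" for y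
  have ext: "(\<Sum>y\<in>Y \<union> Z. (if y \<in> A then w y else 0) * K x y) = (\<Sum>y\<in>A. w y * K x y)"
    if "A \<subseteq> Y \<union> Z" for A w x
  proof -
    have "(\<Sum>y\<in>Y \<union> Z. (if y \<in> A then w y else 0) * K x y)
        = (\<Sum>y\<in>Y \<union> Z. if y \<in> A then w y * K x y else 0)"
      by (rule sum.cong) auto
    also have "\<dots> = (\<Sum>y\<in>(Y \<union> Z) \<inter> A. w y * K x y)"
      using Y(1) Z(1) by (simp add: sum.inter_restrict)
    also have "(Y \<union> Z) \<inter> A = A" using that by blast
    finally show ?thesis .
  qed
  have "(\<Sum>y\<in>Y \<union> Z. c y * K x y) = (\<Sum>y\<in>Y. a y * K x y) + (\<Sum>y\<in>Z. b y * K x y)" for x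
    by (simp add: c_def distrib_right sum.distrib ext)
  then have "\<bar>f x + g x - (\<Sum>y\<in>Y \<union> Z. c y * K x y)\<bar> \<le> e" if "x \<in> X" for x
    using Y(3)[OF that] Z(3)[OF that] by (simp add: abs_le_iff) argo
  then show "\<exists>Y \<alpha>. finite Y \<and> Y \<subseteq> B \<and> (\<forall>x\<in>X. \<bar>f x + g x - (\<Sum>y\<in>Y. \<alpha> y * K x y)\<bar> \<le> e)"
    using Y Z by (intro exI[of _ "Y \<union> Z"] exI[of _ c]) auto
qed

lemma kernel_approx_cmult:
  assumes "kernel_approx K B X f"
  shows "kernel_approx K B X (\<lambda>x. c * f x)"
  unfolding kernel_approx_def
proof (intro allI impI)
  fix e :: real assume e: "e > 0"
  then have e': "e / (\<bar>c\<bar> + 1) > 0" by simp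
  obtain Y a where Y: "finite Y" "Y \<subseteq> B"
    "\<And>x. x \<in> X \<Longrightarrow> \<bar>f x - (\<Sum>y\<in>Y. a y * K x y)\<bar> \<le> e / (\<bar>c\<bar> + 1)"
    by (rule kernel_approxE[OF assms e']) blast
  have "\<bar>c * f x - (\<Sum>y\<in>Y. (c * a y) * K x y)\<bar> \<le> e" if "x \<in> X" for x
  proof -
    have "c * f x - (\<Sum>y\<in>Y. (c * a y) * K x y) = c * (f x - (\<Sum>y\<in>Y. a y * K x y))"
      by (simp add: right_diff_distrib sum_distrib_left mult.assoc)
    then have "\<bar>c * f x - (\<Sum>y\<in>Y. (c * a y) * K x y)\<bar> \<le> \<bar>c\<bar> * (e / (\<bar>c\<bar> + 1))"
      using mult_left_mono[OF Y(3)[OF that] abs_ge_zero[of c]] by (simp add: abs_mult)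
    also have "\<dots> \<le> e"
      using e by (simp add: field_simps)
    finally show ?thesis .
  qed
  then show "\<exists>Y \<alpha>. finite Y \<and> Y \<subseteq> B \<and> (\<forall>x\<in>X. \<bar>c * f x - (\<Sum>y\<in>Y. \<alpha> y * K x y)\<bar> \<le> e)"
    using Y by (intro exI[of _ Y] exI[of _ "\<lambda>y. c * a y"]) auto
qed

lemma kernel_approx_diff:
  "kernel_approx K B X f \<Longrightarrow> kernel_approx K B X g \<Longrightarrow> kernel_approx K B X (\<lambda>x. f x - g x)"
  using kernel_approx_add[of K B X f "\<lambda>x. (-1) * g x"] kernel_approx_cmult[of K B X g "-1"] by simp

lemma kernel_approx_sum:
  "(\<And>i. i \<in> I \<Longrightarrow> kernel_approx K B X (f i)) \<Longrightarrow> kernel_approx K B X (\<lambda>x. \<Sum>i\<in>I. f i x)"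
  by (induction I rule: infinite_finite_induct) (simp_all add: kernel_approx_zero kernel_approx_add)

lemma kernel_approx_limit:
  assumes "\<And>\<epsilon>. \<epsilon> > 0 \<Longrightarrow> \<exists>g. kernel_approx K B X g \<and> (\<forall>x\<in>X. \<bar>f x - g x\<bar> \<le> \<epsilon>)"
  shows "kernel_approx K B X f"
  unfolding kernel_approx_def
proof (intro allI impI)
  fix e :: real assume "e > 0"
  then have e2: "e / 2 > 0" by simp
  obtain g where g: "kernel_approx K B X g" "\<And>x. x \<in> X \<Longrightarrow> \<bar>f x - g x\<bar> \<le> e / 2"
    using assms[OF e2] by blast
  obtain Y a where Y: "finite Y" "Y \<subseteq> B" "\<And>x. x \<in> X \<Longrightarrow> \<bar>g x - (\<Sum>y\<in>Y. a y * K x y)\<bar> \<le> e / 2"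
    by (rule kernel_approxE[OF g(1) e2]) blast
  have "\<bar>f x - (\<Sum>y\<in>Y. a y * K x y)\<bar> \<le> e" if "x \<in> X" for x
    using g(2)[OF that] Y(3)[OF that] by linarith
  then show "\<exists>Y \<alpha>. finite Y \<and> Y \<subseteq> B \<and> (\<forall>x\<in>X. \<bar>f x - (\<Sum>y\<in>Y. \<alpha> y * K x y)\<bar> \<le> e)"
    using Y by (intro exI[of _ Y] exI[of _ a]) auto
qed

text \<open>
  The difference quotients lie in the span, and they converge uniformly on \<open>X\<close> by the mean value
  theorem, since \<open>H'\<close> is uniformly continuous on compact sets of parameters.
\<close>
lemma kernel_approx_derivative:
  fixes H :: "real \<Rightarrow> 'a::metric_space \<Rightarrow> real"
  assumes X: "compact X"
    and H: "\<And>t. t \<in> {-r<..<r} \<Longrightarrow> kernel_approx K B X (H t)"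
    and der: "\<And>t x. t \<in> {-r<..<r} \<Longrightarrow> x \<in> X \<Longrightarrow> ((\<lambda>t. H t x) has_real_derivative H' t x) (at t)"
    and cont: "continuous_on ({-r<..<r} \<times> X) (\<lambda>(t, x). H' t x)"
    and t: "t \<in> {-r<..<r}"
  shows "kernel_approx K B X (H' t)"
proof (rule kernel_approx_limit)
  fix e :: real assume e: "e > 0"
  define \<rho> where "\<rho> = (r - \<bar>t\<bar>) / 2"
  have \<rho>: "\<rho> > 0" and sub: "{t - \<rho>..t + \<rho>} \<subseteq> {-r<..<r}"
    using t by (auto simp: \<rho>_def abs_if field_simps split: if_splits)
  have "uniformly_continuous_on ({t - \<rho>..t + \<rho>} \<times> X) (\<lambda>(t, x). H' t x)"
    using sub X by (intro compact_uniformly_continuous continuous_on_subset[OF cont] compact_Times) auto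
  then obtain \<delta> where \<delta>: "\<delta> > 0"
    "\<And>z w. z \<in> {t - \<rho>..t + \<rho>} \<times> X \<Longrightarrow> w \<in> {t - \<rho>..t + \<rho>} \<times> X \<Longrightarrow> dist z w < \<delta> \<Longrightarrow>
       dist ((\<lambda>(t, x). H' t x) z) ((\<lambda>(t, x). H' t x) w) < e"
    using e unfolding uniformly_continuous_on_def by metis
  define h where "h = min \<rho> (\<delta> / 2)"
  have h: "h > 0" "h \<le> \<rho>" "h < \<delta>" using \<rho> \<delta>(1) by (auto simp: h_def)
  have "t + h \<in> {t - \<rho>..t + \<rho>}" using h by auto
  then have th: "t + h \<in> {-r<..<r}" using sub by blast
  let ?g = "\<lambda>x. (1 / h) * (H (t + h) x - H t x)"
  have "kernel_approx K B X ?g"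
    by (intro kernel_approx_cmult kernel_approx_diff H th t)
  moreover have "\<bar>H' t x - ?g x\<bar> \<le> e" if x: "x \<in> X" for x
  proof -
    have "\<exists>z>t. z < t + h \<and> H (t + h) x - H t x = (t + h - t) * H' z x"
    proof (rule MVT2)
      fix z assume "t \<le> z" "z \<le> t + h"
      then have "z \<in> {t - \<rho>..t + \<rho>}" using h by auto
      then show "((\<lambda>t. H t x) has_real_derivative H' z x) (at z)" using sub by (intro der x) blast
    qed (use h in simp)
    then obtain z where z: "z > t" "z < t + h" "H (t + h) x - H t x = h * H' z x" by auto
    have "dist (H' z x) (H' t x) < e"
      using \<delta>(2)[of "(z, x)" "(t, x)"] z h x by (auto simp: dist_Pair_Pair dist_real_def)
    then show ?thesis using z(3) h by (simp add: dist_real_def)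
  qed
  ultimately show "\<exists>g. kernel_approx K B X g \<and> (\<forall>x\<in>X. \<bar>H' t x - g x\<bar> \<le> e)" by blast
qed

text \<open>
  A Riemann sum argument. The domain of integration is divided by a partition of unity instead of
  measurable pieces, so that all integrands remain continuous.
\<close>
lemma kernel_approx_integral:
  fixes K :: "'a::metric_space \<Rightarrow> 'b::euclidean_space \<Rightarrow> real" and g :: "'b \<Rightarrow> real"
  assumes X: "compact X" and B: "compact B"
    and K: "continuous_on (X \<times> B) (\<lambda>(x, y). K x y)" and g: "continuous_on B g"
  shows "kernel_approx K B X (\<lambda>x. LINT y:B|lborel. g y * K x y)"
proof (rule kernel_approx_limit)
  fix e :: real assume e: "e > 0"
  have int: "set_integrable lborel B f" if "continuous_on B f" for f :: "'b \<Rightarrow> real"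
    unfolding set_integrable_def using borel_integrable_compact[OF B that] .
  have Kx: "continuous_on B (K x)" if "x \<in> X" for x
    using continuous_on_compose2[OF K, of B "\<lambda>y. (x, y)"] that
    by (force intro: continuous_on_Pair continuous_on_const continuous_on_id)
  define G where "G = (LINT y:B|lborel. \<bar>g y\<bar>)"
  have G: "G \<ge> 0" unfolding G_def set_lebesgue_integral_def by (intro integral_nonneg_AE) auto
  define \<eta> where "\<eta> = e / (G + 1)"
  have \<eta>: "\<eta> > 0" using e G by (simp add: \<eta>_def)
  have "uniformly_continuous_on (X \<times> B) (\<lambda>(x, y). K x y)"
    by (intro compact_uniformly_continuous K compact_Times X B)
  then obtain \<delta> where \<delta>: "\<delta> > 0"
    "\<And>z w. z \<in> X \<times> B \<Longrightarrow> w \<in> X \<times> B \<Longrightarrow> dist z w < \<delta> \<Longrightarrow>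
       dist ((\<lambda>(x, y). K x y) z) ((\<lambda>(x, y). K x y) w) < \<eta>"
    using \<eta> unfolding uniformly_continuous_on_def by metis
  obtain C where C: "finite C" "C \<subseteq> B" "B \<subseteq> (\<Union>c\<in>C. ball c \<delta>)"
    using compactE_image[OF B, of B "\<lambda>c. ball c \<delta>"] \<delta>(1) by force
  \<comment> \<open>The functions \<open>w c / W\<close> are a partition of unity on \<open>B\<close> subordinate to the \<open>\<delta>\<close>-balls.\<close>
  define w where "w c y = max 0 (\<delta> - dist y c)" for c y :: 'b
  define W where "W y = (\<Sum>c\<in>C. w c y)" for y
  have w0: "w c y \<ge> 0" for c y by (simp add: w_def)
  have Wpos: "W y > 0" if "y \<in> B" for y
  proof -
    obtain c where "c \<in> C" "dist y c < \<delta>" using C(3) \<open>y \<in> B\<close> by (auto simp: dist_commute)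
    then show ?thesis unfolding W_def using C(1) w0 by (intro sum_pos2[of _ c]) (auto simp: w_def)
  qed
  have cw: "continuous_on B (w c)" for c unfolding w_def by (intro continuous_intros)
  have cW: "continuous_on B W" unfolding W_def by (intro continuous_intros cw)
  define a where "a c = (LINT y:B|lborel. g y * (w c y / W y))" for c
  let ?g = "\<lambda>x. \<Sum>c\<in>C. a c * K x c"
  have "kernel_approx K B X ?g" using C by (intro kernel_approxI[of C]) auto
  moreover have "\<bar>(LINT y:B|lborel. g y * K x y) - ?g x\<bar> \<le> e" if x: "x \<in> X" for x
  proof -
    have cgw: "continuous_on B (\<lambda>y. g y * (w c y / W y))" for c
      using Wpos by (intro continuous_intros g cw cW) (metis less_irrefl)
    have c1: "continuous_on B (\<lambda>y. g y * K x y)"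
      by (intro continuous_intros g Kx x)
    have c2: "continuous_on B (\<lambda>y. \<Sum>c\<in>C. g y * (w c y / W y) * K x c)"
      by (intro continuous_on_sum continuous_on_mult cgw continuous_on_const)
    have "?g x = (\<Sum>c\<in>C. LINT y:B|lborel. g y * (w c y / W y) * K x c)"
      unfolding a_def by (intro sum.cong refl set_integral_mult_left[symmetric])
    also have "\<dots> = (LINT y:B|lborel. \<Sum>c\<in>C. g y * (w c y / W y) * K x c)"
      unfolding set_lebesgue_integral_def sum_distrib_left scaleR_sum_right
      by (rule Bochner_Integration.integral_sum[symmetric])
         (rule int[unfolded set_integrable_def], intro continuous_intros cgw)
    finally have "(LINT y:B|lborel. g y * K x y) - ?g x
        = (LINT y:B|lborel. g y * K x y - (\<Sum>c\<in>C. g y * (w c y / W y) * K x c))"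
      using set_integral_diff(2)[OF int[OF c1] int[OF c2]] by simp
    also have "\<bar>\<dots>\<bar> \<le> (LINT y:B|lborel. \<bar>g y * K x y - (\<Sum>c\<in>C. g y * (w c y / W y) * K x c)\<bar>)"
      unfolding set_lebesgue_integral_def
      by (rule order.trans[OF integral_abs_bound]) (simp add: abs_mult)
    also have "\<dots> \<le> (LINT y:B|lborel. \<bar>g y\<bar> * \<eta>)"
    proof (rule set_integral_mono)
      fix y assume y: "y \<in> B"
      have "g y * K x y - (\<Sum>c\<in>C. g y * (w c y / W y) * K x c)
          = g y * ((\<Sum>c\<in>C. w c y / W y) * K x y - (\<Sum>c\<in>C. w c y / W y * K x c))"
        using Wpos[OF y] by (simp add: W_def[symmetric] sum_divide_distrib[symmetric]
            right_diff_distrib sum_distrib_left mult.assoc)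
      also have "\<dots> = g y * (\<Sum>c\<in>C. w c y / W y * (K x y - K x c))"
        by (simp add: right_diff_distrib sum_subtractf sum_distrib_right)
      finally have "\<bar>g y * K x y - (\<Sum>c\<in>C. g y * (w c y / W y) * K x c)\<bar>
          = \<bar>g y\<bar> * \<bar>\<Sum>c\<in>C. w c y / W y * (K x y - K x c)\<bar>" by (simp add: abs_mult)
      also have "\<bar>\<Sum>c\<in>C. w c y / W y * (K x y - K x c)\<bar> \<le> (\<Sum>c\<in>C. w c y / W y * \<eta>)"
      proof (rule order.trans[OF sum_abs sum_mono])
        fix c assume c: "c \<in> C"
        show "\<bar>w c y / W y * (K x y - K x c)\<bar> \<le> w c y / W y * \<eta>"
        proof (cases "dist y c < \<delta>")
          case True
          have "\<bar>K x y - K x c\<bar> \<le> \<eta>"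
            using \<delta>(2)[of "(x, y)" "(x, c)"] True x y c C(2) by (auto simp: dist_Pair_Pair dist_real_def)
          then show ?thesis using w0[of c y] Wpos[OF y]
            by (simp add: abs_mult divide_right_mono mult_left_mono)
        next
          case False
          then show ?thesis by (simp add: w_def)
        qed
      qed
      also have "(\<Sum>c\<in>C. w c y / W y * \<eta>) = \<eta>"
        using Wpos[OF y] by (simp add: W_def[symmetric] sum_divide_distrib[symmetric] sum_distrib_right[symmetric])
      finally show "\<bar>g y * K x y - (\<Sum>c\<in>C. g y * (w c y / W y) * K x c)\<bar> \<le> \<bar>g y\<bar> * \<eta>"
        by (simp add: mult_left_mono)
    qed (intro int continuous_on_rabs continuous_on_diff c1 c2 continuous_on_mult g continuous_on_const)+
    also have "\<dots> = G * \<eta>" by (simp add: G_def)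
    also have "\<dots> \<le> e" using e G by (simp add: \<eta>_def field_simps)
    finally show ?thesis .
  qed
  ultimately show "\<exists>h. kernel_approx K B X h \<and> (\<forall>x\<in>X. \<bar>(LINT y:B|lborel. g y * K x y) - h x\<bar> \<le> e)" by blast
qed

section \<open>Radial profiles and their iterated Laplacians\<close>

text \<open>
  Odd and even dimensions are treated at once by regarding \<open>q\<^sup>s ln q\<close> as the derivative of \<open>q\<^sup>a\<close> with
  respect to the exponent \<open>a\<close> at \<open>a = s\<close>. A profile is the functional \<open>g \<mapsto> \<alpha> g(s) + \<beta> g'(s)\<close> applied to
  \<open>a \<mapsto> c(a) q\<^sup>a\<^sup>-\<^sup>m\<close>. The calculus of powers of \<open>q\<close>, with coefficients polynomial in the
  exponent, therefore carries over to the logarithmic case without change.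
\<close>
definition profile :: "real \<Rightarrow> real \<Rightarrow> real \<Rightarrow> real poly \<Rightarrow> nat \<Rightarrow> real \<Rightarrow> real" where
  "profile \<alpha> \<beta> s c m q =
     (\<alpha> * poly c s + \<beta> * (poly (pderiv c) s + poly c s * ln q)) * q powr (s - real m)"

lemma profile_has_derivative:
  assumes "q > 0"
  shows "(profile \<alpha> \<beta> s c m has_real_derivative profile \<alpha> \<beta> s ([:- real m, 1:] * c) (Suc m) q) (at q)"
proof -
  have "(profile \<alpha> \<beta> s c m has_real_derivative
      (\<beta> * (poly c s / q)) * q powr (s - real m)
      + (\<alpha> * poly c s + \<beta> * (poly (pderiv c) s + poly c s * ln q)) * ((s - real m) * q powr (s - real m - 1))) (at q)"
    unfolding profile_def using assms by (auto intro!: derivative_eq_intros)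
  also have "q powr (s - real m) = q * q powr (s - real m - 1)"
    using assms by (simp add: powr_diff)
  also have "(\<beta> * (poly c s / q)) * (q * q powr (s - real m - 1))
      + (\<alpha> * poly c s + \<beta> * (poly (pderiv c) s + poly c s * ln q)) * ((s - real m) * q powr (s - real m - 1))
      = profile \<alpha> \<beta> s ([:- real m, 1:] * c) (Suc m) q"
    using assms unfolding profile_def by (simp add: pderiv_mult pderiv_pCons algebra_simps del: mult_pCons_left mult_pCons_right)
  finally show ?thesis .
qed

lemma profile_continuous: "continuous_on {0<..} (profile \<alpha> \<beta> s c m)"
  unfolding profile_def by (auto intro!: continuous_intros)

lemma profile_lower: "q > 0 \<Longrightarrow> q * profile \<alpha> \<beta> s c (Suc m) q = profile \<alpha> \<beta> s c m q"
  unfolding profile_def by (simp add: powr_diff powr_add)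

lemma profile_add: "profile \<alpha> \<beta> s (c + c') m q = profile \<alpha> \<beta> s c m q + profile \<alpha> \<beta> s c' m q"
  unfolding profile_def by (simp add: pderiv_add algebra_simps)

lemma profile_smult: "profile \<alpha> \<beta> s (smult a c) m q = a * profile \<alpha> \<beta> s c m q"
  unfolding profile_def by (simp add: pderiv_smult algebra_simps)

lemma profile_zero: "profile \<alpha> \<beta> s 0 m q = 0"
  unfolding profile_def by simp

text \<open>
  The coefficient of the \<open>n\<close>-th derivative of \<open>q\<^sup>a\<close>, as a polynomial in \<open>a\<close>.
\<close>
definition falling_poly :: "nat \<Rightarrow> real poly" where
  "falling_poly n = (\<Prod>l<n. [:- real l, 1:])"

lemma falling_poly_Suc: "falling_poly (Suc n) = [:- real n, 1:] * falling_poly n"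
  by (simp add: falling_poly_def mult.commute)

text \<open>
  On radial functions \<open>u(|x|\<^sup>2 + e)\<close> in dimension \<open>D\<close> the Laplacian acts as \<open>2 D u' + 4 (q - e) u''\<close>, where
  \<open>q = |x|\<^sup>2 + e\<close>. Applied \<open>j\<close> times to \<open>q\<^sup>a\<close> it produces \<open>4\<^sup>j\<close> times the sum over \<open>i \<le> j\<close> of
  \<open>e\<^sup>i c\<^sub>j\<^sub>,\<^sub>i(a) q\<^sup>a\<^sup>-\<^sup>j\<^sup>-\<^sup>i\<close>, and the following closed form gives \<open>c\<^sub>j\<^sub>,\<^sub>i\<close>. What matters is the
  factor \<open>a + D/2 - j\<close>, which is present exactly when \<open>i < j\<close>.
\<close>
definition laplace_coeff :: "real \<Rightarrow> nat \<Rightarrow> nat \<Rightarrow> real poly" where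
  "laplace_coeff D j i = smult ((-1) ^ i * real (j choose i))
     (falling_poly (j + i) * (\<Prod>l=Suc i..j. [:D / 2 - real l, 1:]))"

lemma laplace_coeff_rec_0:
  "laplace_coeff D (Suc j) 0 =
     [:- real j, 1:] * [:D / 2 - real (Suc j), 1:] * laplace_coeff D j 0"
proof -
  have "(\<Prod>l=Suc 0..Suc j. [:D / 2 - real l, 1:])
      = [:D / 2 - real (Suc j), 1:] * (\<Prod>l=Suc 0..j. [:D / 2 - real l, 1:])"
    by (subst prod.nat_ivl_Suc') auto
  then show ?thesis
    by (simp add: laplace_coeff_def falling_poly_Suc mult_ac del: mult_pCons_left mult_pCons_right)
qed

text \<open>
  For \<open>i < j\<close> all terms share the falling factorial of order \<open>j + i\<close> and the product over \<open>l > i + 1\<close>; what remains is Pascal's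
  rule combined with \<open>(i + 1) (j choose (i + 1)) = (j - i) (j choose i)\<close>.
\<close>
lemma laplace_coeff_rec_Suc:
  "laplace_coeff D (Suc j) (Suc i) =
     [:- real (j + Suc i), 1:] * [:D / 2 - real (j + i + 2), 1:] * laplace_coeff D j (Suc i)
     - [:- real (Suc (j + i)), 1:] * [:- real (j + i), 1:] * laplace_coeff D j i"
proof -
  consider "i < j" | "i = j" | "i > j" by linarith
  then show ?thesis
  proof cases
    case 1
    define P where "P = (\<Prod>l=Suc (Suc i)..j. [:D / 2 - real l, 1:])"
    have P1: "(\<Prod>l=Suc i..j. [:D / 2 - real l, 1:]) = [:D / 2 - real (Suc i), 1:] * P"
      unfolding P_def using 1 by (subst prod.atLeast_Suc_atMost) auto
    have P2: "(\<Prod>l=Suc (Suc i)..Suc j. [:D / 2 - real l, 1:]) = [:D / 2 - real (Suc j), 1:] * P"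
      unfolding P_def using 1 by (subst prod.nat_ivl_Suc') auto
    have "Suc i * (j choose Suc i) = (j - i) * (j choose i)"
      by (metis binomial_absorb_comp binomial_absorption)
    then have "real (Suc i * (j choose Suc i)) = real ((j - i) * (j choose i))" by (simp only:)
    then have B: "(real i + 1) * real (j choose Suc i) = (real j - real i) * real (j choose i)"
      using 1 by (simp add: of_nat_diff algebra_simps)
    define F where "F = falling_poly (j + i)"
    have F: "falling_poly (Suc j + Suc i) = [:- real (Suc (j + i)), 1:] * [:- real (j + i), 1:] * F"
      "falling_poly (j + Suc i) = [:- real (j + i), 1:] * F"
      by (simp_all add: F_def falling_poly_Suc mult.assoc del: mult_pCons_left mult_pCons_right of_nat_Suc)
    show ?thesis
    proof (rule poly_eq_poly_eq_iff[THEN iffD1], rule ext)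
      fix x
      define f where "f = poly F x"
      define p where "p = poly P x"
      define u where "u = real (j choose i)"
      define v where "v = real (j choose Suc i)"
      have key: "(x + D/2 - (real j + 1)) * (u + v)
         = (x + D/2 - (real j + real i + 2)) * v + (x + D/2 - (real i + 1)) * u"
        using B unfolding u_def v_def by (simp add: algebra_simps)
      have lin: "poly [:- a, 1:] x = x - a" "poly [:D / 2 - a, 1:] x = x + D / 2 - a" for a by simp_all
      have shift: "real (j + Suc i) = real (Suc (j + i))" "real (j + i + 2) = real j + real i + 2"
        "real (Suc i) = real i + 1" "real (Suc j) = real j + 1" by simp_all
      have combine: "- m * (u + v) * (a * b * f * (cj * p)) = a * e * (- m * v * (b * f * p)) - a * b * (m * u * (f * (ci * p)))"
        if "cj * (u + v) = e * v + ci * u" for m a b e ci cj :: real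
        using that by algebra
      have "poly (laplace_coeff D (Suc j) (Suc i)) x
          = - ((-1) ^ i) * (u + v) * ((x - real (Suc (j + i))) * (x - real (j + i)) * f * ((x + D / 2 - (real j + 1)) * p))"
        unfolding laplace_coeff_def P2 F binomial_Suc_Suc
        by (simp only: poly_smult poly_mult lin shift of_nat_add power_Suc mult_minus1
            f_def p_def u_def v_def)
      moreover have "poly (laplace_coeff D j (Suc i)) x = - ((-1) ^ i) * v * ((x - real (j + i)) * f * p)"
        unfolding laplace_coeff_def F P_def[symmetric]
        by (simp only: poly_smult poly_mult lin power_Suc mult_minus1 f_def p_def v_def)
      moreover have "poly (laplace_coeff D j i) x = (-1) ^ i * u * (f * ((x + D / 2 - (real i + 1)) * p))"
        unfolding laplace_coeff_def P1 F_def[symmetric]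
        by (simp only: poly_smult poly_mult lin shift f_def p_def u_def)
      ultimately show "poly (laplace_coeff D (Suc j) (Suc i)) x = poly ([:- real (j + Suc i), 1:] * [:D / 2 - real (j + i + 2), 1:] * laplace_coeff D j (Suc i)
     - [:- real (Suc (j + i)), 1:] * [:- real (j + i), 1:] * laplace_coeff D j i) x"
        using combine[OF key] by (simp only: poly_diff poly_mult lin shift)
    qed
  next
    case 2
    then show ?thesis
      by (simp add: laplace_coeff_def falling_poly_Suc mult_ac del: mult_pCons_left mult_pCons_right)
  next
    case 3
    then show ?thesis by (simp add: laplace_coeff_def binomial_eq_0 del: binomial_Suc_Suc)
  qed
qed

text \<open>
  The radial form of the \<open>j\<close>-th Laplacian of \<open>\<psi>(|x|\<^sup>2 + e)\<close>, as a function of \<open>q = |x|\<^sup>2 + e\<close>;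
  the primed versions are its first two derivatives.
\<close>
definition laplace_profile :: "real \<Rightarrow> real \<Rightarrow> real \<Rightarrow> real \<Rightarrow> real \<Rightarrow> nat \<Rightarrow> real \<Rightarrow> real" where
  "laplace_profile \<alpha> \<beta> s D e j q =
     4 ^ j * (\<Sum>i\<le>j. e ^ i * profile \<alpha> \<beta> s (laplace_coeff D j i) (j + i) q)"

definition laplace_profile' :: "real \<Rightarrow> real \<Rightarrow> real \<Rightarrow> real \<Rightarrow> real \<Rightarrow> nat \<Rightarrow> real \<Rightarrow> real" where
  "laplace_profile' \<alpha> \<beta> s D e j q =
     4 ^ j * (\<Sum>i\<le>j. e ^ i *
       profile \<alpha> \<beta> s ([:- real (j + i), 1:] * laplace_coeff D j i) (Suc (j + i)) q)"

definition laplace_profile'' :: "real \<Rightarrow> real \<Rightarrow> real \<Rightarrow> real \<Rightarrow> real \<Rightarrow> nat \<Rightarrow> real \<Rightarrow> real" where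
  "laplace_profile'' \<alpha> \<beta> s D e j q =
     4 ^ j * (\<Sum>i\<le>j. e ^ i *
       profile \<alpha> \<beta> s ([:- real (Suc (j + i)), 1:] * ([:- real (j + i), 1:] * laplace_coeff D j i))
         (Suc (Suc (j + i))) q)"

lemma laplace_profile_derivatives:
  assumes "q > 0"
  shows "(laplace_profile \<alpha> \<beta> s D e j has_real_derivative laplace_profile' \<alpha> \<beta> s D e j q) (at q)"
    and "(laplace_profile' \<alpha> \<beta> s D e j has_real_derivative laplace_profile'' \<alpha> \<beta> s D e j q) (at q)"
  unfolding laplace_profile_def laplace_profile'_def laplace_profile''_def
  by (intro DERIV_cmult DERIV_sum profile_has_derivative assms)+

lemma laplace_profile_continuous:
  "continuous_on {0<..} (laplace_profile \<alpha> \<beta> s D e j)"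
  "continuous_on {0<..} (laplace_profile' \<alpha> \<beta> s D e j)"
  "continuous_on {0<..} (laplace_profile'' \<alpha> \<beta> s D e j)"
  unfolding laplace_profile_def laplace_profile'_def laplace_profile''_def
  by (intro continuous_intros profile_continuous)+

lemma laplace_profile_0: "laplace_profile \<alpha> \<beta> s D e 0 q = profile \<alpha> \<beta> s 1 0 q"
  by (simp add: laplace_profile_def laplace_coeff_def falling_poly_def one_pCons)

text \<open>
  Writing \<open>q - e\<close> as the two terms \<open>q\<close> and \<open>- e\<close>, the first raises the power of \<open>q\<close> back by one and merges with
  \<open>2 D u'\<close>, while the second moves the index \<open>i\<close> up by one. Comparing coefficients gives the recursion
  for \<^const>\<open>laplace_coeff\<close>.
\<close>
lemma laplace_profile_Suc:
  assumes q: "q > 0"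
  shows "2 * D * laplace_profile' \<alpha> \<beta> s D e j q + 4 * (q - e) * laplace_profile'' \<alpha> \<beta> s D e j q
    = laplace_profile \<alpha> \<beta> s D e (Suc j) q"
proof -
  let ?P = "profile \<alpha> \<beta> s"
  let ?c = "laplace_coeff D j"
  define A where "A i = ?P ([:- real (j + i), 1:] * [:D / 2 - real (Suc (j + i)), 1:] * ?c i) (Suc (j + i)) q" for i
  define B where "B i = ?P ([:- real (Suc (j + i)), 1:] * [:- real (j + i), 1:] * ?c i) (Suc (Suc (j + i))) q" for i
  have step: "2 * D * ?P ([:- real (j + i), 1:] * ?c i) (Suc (j + i)) q
      + 4 * (q - e) * ?P ([:- real (Suc (j + i)), 1:] * ([:- real (j + i), 1:] * ?c i)) (Suc (Suc (j + i))) q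
      = 4 * (A i - e * B i)" for i
  proof -
    let ?b = "[:- real (j + i), 1:] * ?c i"
    have "[:- real (j + i), 1:] * [:D / 2 - real (Suc (j + i)), 1:] * ?c i
        = smult (D / 2) ?b + [:- real (Suc (j + i)), 1:] * ?b"
    proof -
      have "[:D / 2 - real (Suc (j + i)), 1:] = [:D / 2:] + [:- real (Suc (j + i)), 1:]" by simp
      then show ?thesis
        by (simp only: distrib_left distrib_right mult.left_commute mult.assoc) simp
    qed
    then have "A i = D / 2 * ?P ?b (Suc (j + i)) q + q * B i"
      unfolding A_def B_def by (simp only: profile_add profile_smult profile_lower[OF q] mult.assoc)
    then show ?thesis unfolding B_def by (simp only: mult.assoc) (simp add: algebra_simps del: mult_pCons_left mult_pCons_right)
  qed
  have "2 * D * laplace_profile' \<alpha> \<beta> s D e j q + 4 * (q - e) * laplace_profile'' \<alpha> \<beta> s D e j q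
     = 4 ^ j * (\<Sum>i\<le>j. e ^ i * (2 * D * ?P ([:- real (j + i), 1:] * ?c i) (Suc (j + i)) q
      + 4 * (q - e) * ?P ([:- real (Suc (j + i)), 1:] * ([:- real (j + i), 1:] * ?c i)) (Suc (Suc (j + i))) q))"
    unfolding laplace_profile'_def laplace_profile''_def
    by (simp only: distrib_left sum.distrib sum_distrib_left mult_ac)
  also have "\<dots> = 4 ^ Suc j * (\<Sum>i\<le>j. e ^ i * A i - e ^ Suc i * B i)"
    unfolding step by (simp add: sum_distrib_left algebra_simps)
  also have "(\<Sum>i\<le>j. e ^ i * A i - e ^ Suc i * B i) = A 0 + (\<Sum>i\<le>j. e ^ Suc i * (A (Suc i) - B i))"
  proof -
    have "laplace_coeff D j (Suc j) = 0" by (simp add: laplace_coeff_def)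
    then have "A (Suc j) = 0" by (simp add: A_def profile_zero)
    then have "(\<Sum>i\<le>j. e ^ i * A i) = (\<Sum>i\<le>Suc j. e ^ i * A i)" by simp
    also have "\<dots> = A 0 + (\<Sum>i\<le>j. e ^ Suc i * A (Suc i))" by (subst sum.atMost_Suc_shift) simp
    finally show ?thesis by (simp add: sum_subtractf right_diff_distrib)
  qed
  also have "\<dots> = (\<Sum>i\<le>Suc j. e ^ i * ?P (laplace_coeff D (Suc j) i) (Suc j + i) q)"
  proof -
    have "A (Suc i) - B i = ?P (laplace_coeff D (Suc j) (Suc i)) (Suc j + Suc i) q" for i
    proof -
      have "?P (laplace_coeff D (Suc j) (Suc i)) (Suc j + Suc i) q + B i = A (Suc i)"
        unfolding A_def B_def laplace_coeff_rec_Suc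
        by (simp add: profile_add[symmetric] del: mult_pCons_left mult_pCons_right)
      then show ?thesis by linarith
    qed
    moreover have "A 0 = ?P (laplace_coeff D (Suc j) 0) (Suc j + 0) q"
      by (simp add: A_def laplace_coeff_rec_0 del: mult_pCons_left mult_pCons_right)
    ultimately show ?thesis by (subst sum.atMost_Suc_shift) simp
  qed
  finally show ?thesis unfolding laplace_profile_def .
qed

text \<open>
  The first alternative is \<open>\<psi>(q) = q\<^sup>s\<close> with \<open>s\<close> not an integer (odd dimension), the second is
  \<open>\<psi>(q) = (1/2) q\<^sup>s ln q\<close> with integer \<open>s\<close> (even dimension).
\<close>
definition spline_parameters :: "real \<Rightarrow> real \<Rightarrow> real \<Rightarrow> bool" where
  "spline_parameters \<alpha> \<beta> s \<longleftrightarrow> s > 0 \<and>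
     (\<alpha> = 1 \<and> \<beta> = 0 \<and> (\<forall>n::nat. s \<noteq> real n) \<or> \<alpha> = 0 \<and> \<beta> = 1 / 2 \<and> (\<exists>n::nat. s = real n))"

lemma poly_falling_poly: "poly (falling_poly n) x = (\<Prod>l<n. x - real l)"
  by (simp add: falling_poly_def poly_prod)

text \<open>
  For \<open>n > N\<close> the falling factorial has a simple root at \<open>N\<close>; for \<open>1 \<le> n \<le> N\<close> all its factors are positive there,
  and so is its derivative. In both cases the derivative at \<open>N\<close>, which governs the logarithmic case, is nonzero.
\<close>
lemma falling_poly_at_nat:
  "(n \<le> N \<longrightarrow> poly (falling_poly n) (real N) > 0 \<and> poly (pderiv (falling_poly n)) (real N) \<ge> 0 \<and>
      (n \<ge> 1 \<longrightarrow> poly (pderiv (falling_poly n)) (real N) > 0)) \<and>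
   (n > N \<longrightarrow> poly (falling_poly n) (real N) = 0 \<and> poly (pderiv (falling_poly n)) (real N) \<noteq> 0)"
proof (induction n)
  case 0
  then show ?case by (simp add: falling_poly_def)
next
  case (Suc n)
  have eval: "poly (falling_poly (Suc n)) (real N) = (real N - real n) * poly (falling_poly n) (real N)"
    by (simp add: falling_poly_Suc del: mult_pCons_left)
  have eval': "poly (pderiv (falling_poly (Suc n))) (real N) =
     (real N - real n) * poly (pderiv (falling_poly n)) (real N) + poly (falling_poly n) (real N)"
    by (simp add: falling_poly_Suc pderiv_mult pderiv_pCons del: mult_pCons_left)
  consider "n < N" | "n = N" | "n > N" by linarith
  then show ?case
  proof cases
    case 1
    then show ?thesis using Suc eval eval' by (auto intro!: add_nonneg_pos mult_nonneg_nonneg)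
  next
    case 2
    then show ?thesis using Suc eval eval' by auto
  next
    case 3
    then show ?thesis using Suc eval eval' by auto
  qed
qed

text \<open>
  The value is the \<open>n\<close>-th derivative of \<open>\<psi>\<close> at \<open>1\<close>. For \<open>\<psi>(q) = (1/2) q\<^sup>s ln q\<close> it vanishes for \<open>n = 0\<close>.
\<close>
lemma profile_falling_poly_nonzero:
  assumes "spline_parameters \<alpha> \<beta> s" "n \<ge> 1"
  shows "profile \<alpha> \<beta> s (falling_poly n) n 1 \<noteq> 0"
proof (cases "\<beta> = 0")
  case True
  then have "\<alpha> = 1" "\<forall>l::nat. s \<noteq> real l" using assms(1) by (auto simp: spline_parameters_def)
  then show ?thesis using True by (simp add: profile_def poly_falling_poly)
next
  case False
  then obtain N where "\<alpha> = 0" "s = real N" using assms(1) by (auto simp: spline_parameters_def)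
  moreover have "poly (pderiv (falling_poly n)) (real N) \<noteq> 0"
    using falling_poly_at_nat[of n N] assms(2) by (cases "n \<le> N") auto
  ultimately show ?thesis using False by (simp add: profile_def)
qed

text \<open>
  For \<open>i < k\<close> the coefficient contains the factor \<open>a + D/2 - k\<close>, which vanishes at \<open>a = s\<close>. This settles the case
  \<open>\<beta> = 0\<close>. In the logarithmic case \<open>s\<close> is an integer below \<open>k\<close>, so the falling factorial contributes a second
  root at \<open>s\<close> and the derivative of the coefficient vanishes too. Only \<open>i = k\<close> remains.
\<close>
lemma laplace_profile_top:
  assumes par: "spline_parameters \<alpha> \<beta> s" and k: "s + D / 2 = real k" and D: "D > 0"
  obtains \<kappa> where "\<kappa> \<noteq> 0"
    "\<And>e q. q > 0 \<Longrightarrow> laplace_profile \<alpha> \<beta> s D e k q = \<kappa> * e ^ k * q powr (s - 2 * real k)"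
proof -
  have sk: "s < real k" "s > 0" using k D par by (auto simp: spline_parameters_def)
  have "k > 0" using sk by auto
  have root: "\<beta> = 0 \<or> poly (falling_poly n) s = 0" if "n \<ge> k" for n
  proof (cases "\<beta> = 0")
    case False
    then obtain N where "s = real N" using par by (auto simp: spline_parameters_def)
    then have "poly (falling_poly n) s = 0"
      using that sk falling_poly_at_nat[of n N] by auto
    then show ?thesis ..
  qed simp
  have vanish: "profile \<alpha> \<beta> s (laplace_coeff D k i) m q = 0" if "i < k" for i m q
  proof -
    define P where "P = (\<Prod>l=Suc i..k. [:D / 2 - real l, 1:])"
    have P: "poly P s = 0"
      unfolding P_def poly_prod using that k by (intro prod_zero bexI[of _ k]) auto
    have "poly (pderiv (falling_poly (k + i) * P)) s = 0" if "\<beta> \<noteq> 0"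
      using root[of "k + i"] that P by (simp add: pderiv_mult)
    then show ?thesis
      unfolding profile_def laplace_coeff_def P_def[symmetric] using P by (auto simp: pderiv_smult)
  qed
  define \<kappa> where "\<kappa> = (- 1) ^ k * 4 ^ k * profile \<alpha> \<beta> s (falling_poly (2 * k)) (2 * k) 1"
  have "\<kappa> \<noteq> 0"
    using profile_falling_poly_nonzero[OF par, of "2 * k"] \<open>k > 0\<close> by (simp add: \<kappa>_def)
  moreover have "laplace_profile \<alpha> \<beta> s D e k q = \<kappa> * e ^ k * q powr (s - 2 * real k)" if "q > 0" for e q
  proof -
    have "laplace_profile \<alpha> \<beta> s D e k q
        = 4 ^ k * (\<Sum>i\<in>{k}. e ^ i * profile \<alpha> \<beta> s (laplace_coeff D k i) (k + i) q)"
      unfolding laplace_profile_def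
      by (intro arg_cong[of _ _ "\<lambda>x. 4 ^ k * x"] sum.mono_neutral_right) (auto simp: vanish)
    also have "\<dots> = 4 ^ k * e ^ k * (-1) ^ k * profile \<alpha> \<beta> s (falling_poly (2 * k)) (2 * k) q"
      by (simp add: laplace_coeff_def profile_smult mult_2)
    also have "profile \<alpha> \<beta> s (falling_poly (2 * k)) (2 * k) q
        = profile \<alpha> \<beta> s (falling_poly (2 * k)) (2 * k) 1 * q powr (s - 2 * real k)"
      using root[of "2 * k"] by (auto simp: profile_def)
    finally show ?thesis by (simp add: \<kappa>_def mult_ac)
  qed
  ultimately show thesis by (rule that)
qed

section \<open>Integration by parts against compactly supported functions\<close>

text \<open>
  Continuity of the partial derivative is part of the notion, since it is what makes the compactly
  supported integrands below integrable and their difference quotients bounded.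
\<close>
definition has_partial :: "('a::euclidean_space \<Rightarrow> real) \<Rightarrow> 'a \<Rightarrow> ('a \<Rightarrow> real) \<Rightarrow> bool" where
  "has_partial f b f' \<longleftrightarrow> continuous_on UNIV f' \<and>
     (\<forall>x. ((\<lambda>t. f (x + t *\<^sub>R b)) has_real_derivative f' x) (at 0))"

definition has_laplacian :: "('a::euclidean_space \<Rightarrow> real) \<Rightarrow> ('a \<Rightarrow> real) \<Rightarrow> bool" where
  "has_laplacian f g \<longleftrightarrow> (\<exists>f1 f2. (\<forall>b\<in>Basis. has_partial f b (f1 b) \<and> has_partial (f1 b) b (f2 b)) \<and>
     g = (\<lambda>x. \<Sum>b\<in>Basis. f2 b x))"

lemma has_partial_at:
  assumes "has_partial f b f'"
  shows "((\<lambda>t. f (x + t *\<^sub>R b)) has_real_derivative f' (x + t *\<^sub>R b)) (at t)"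
proof -
  have "((\<lambda>s. f ((x + t *\<^sub>R b) + s *\<^sub>R b)) has_real_derivative f' (x + t *\<^sub>R b)) (at 0)"
    using assms unfolding has_partial_def by blast
  also have "(\<lambda>s. f ((x + t *\<^sub>R b) + s *\<^sub>R b)) = (\<lambda>s. f (x + (s + t) *\<^sub>R b))"
    by (simp add: algebra_simps)
  finally show ?thesis
    using DERIV_shift[of "\<lambda>s. f (x + s *\<^sub>R b)" _ 0 t] by simp
qed

lemma has_partial_mult:
  assumes "has_partial f b f'" "has_partial g b g'" "continuous_on UNIV f" "continuous_on UNIV g"
  shows "has_partial (\<lambda>x. f x * g x) b (\<lambda>x. f' x * g x + f x * g' x)"
proof -
  have "((\<lambda>t. f (x + t *\<^sub>R b) * g (x + t *\<^sub>R b)) has_real_derivative f' x * g x + f x * g' x) (at 0)" for x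
    using has_partial_at[OF assms(1), of x 0] has_partial_at[OF assms(2), of x 0]
    by (auto intro!: derivative_eq_intros)
  then show ?thesis
    using assms unfolding has_partial_def by (auto intro!: continuous_intros)
qed

lemma integrable_compact_support:
  fixes f :: "'a::euclidean_space \<Rightarrow> real"
  assumes "continuous_on UNIV f" "\<And>x. norm x > R \<Longrightarrow> f x = 0"
  shows "integrable lborel f"
proof -
  have "integrable lborel (\<lambda>x. indicator (cball 0 R) x *\<^sub>R f x)"
    by (intro borel_integrable_compact continuous_on_subset[OF assms(1)]) auto
  also have "(\<lambda>x. indicator (cball 0 R) x *\<^sub>R f x) = f"
    using assms(2) by (auto simp: indicator_def fun_eq_iff)
  finally show ?thesis .
qed

lemma has_partial_support:
  assumes "has_partial f b f'" "\<And>x. norm x > R \<Longrightarrow> f x = 0" "norm x > R"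
  shows "f' x = 0"
proof -
  have "((\<lambda>t. norm (x + t *\<^sub>R b)) \<longlongrightarrow> norm (x + 0 *\<^sub>R b)) (at 0)"
    by (intro tendsto_intros)
  then have "\<forall>\<^sub>F t in at 0. norm (x + t *\<^sub>R b) > R"
    using assms(3) by (intro order_tendstoD(1)) auto
  then have "\<forall>\<^sub>F t in nhds 0. norm (x + t *\<^sub>R b) > R"
    using assms(3) by (simp add: eventually_nhds_conv_at)
  then have ev: "\<forall>\<^sub>F t in nhds 0. f (x + t *\<^sub>R b) = 0"
    by eventually_elim (rule assms(2))
  have "((\<lambda>t. f (x + t *\<^sub>R b)) has_real_derivative f' x) (at 0)"
    using assms(1) unfolding has_partial_def by blast
  then have "((\<lambda>t::real. 0::real) has_real_derivative f' x) (at 0)"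
    using DERIV_cong_ev[OF refl ev refl] by simp
  then show ?thesis using DERIV_unique[OF _ DERIV_const] by blast
qed

lemma integral_translation:
  fixes f :: "'a::euclidean_space \<Rightarrow> real"
  assumes "f \<in> borel_measurable borel"
  shows "(LINT x|lborel. f (x + c)) = (LINT x|lborel. f x)"
proof -
  have "(LINT x|lborel. f x) = (LINT x|distr lborel borel ((+) c). f x)"
    by (simp add: lborel_distr_plus)
  also have "\<dots> = (LINT x|lborel. f (c + x))"
    using assms by (subst integral_distr) auto
  finally show ?thesis by (simp add: add.commute)
qed

text \<open>
  By translation invariance every difference quotient of \<open>F\<close> in direction \<open>b\<close> has integral zero, and the quotients
  with steps at most \<open>1\<close> are bounded and supported in a fixed ball, so dominated convergence applies.
\<close>
lemma integral_partial_zero: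
  fixes F :: "'a::euclidean_space \<Rightarrow> real"
  assumes F: "continuous_on UNIV F" "\<And>x. norm x > R \<Longrightarrow> F x = 0"
    and F': "has_partial F b F'" and b: "norm b = 1" and R: "R \<ge> 0"
  shows "(LINT x|lborel. F' x) = 0"
proof -
  have contF': "continuous_on UNIV F'" using F' unfolding has_partial_def by blast
  have [measurable]: "F \<in> borel_measurable borel" "F' \<in> borel_measurable borel"
    using F(1) contF' by (auto intro: borel_measurable_continuous_onI)
  have intF: "integrable lborel F" using F by (rule integrable_compact_support)
  define h where "h n = inverse (real (Suc n))" for n
  have h: "h n > 0" "h n \<le> 1" for n by (auto simp: h_def field_simps)
  define D where "D n x = (F (x + h n *\<^sub>R b) - F x) / h n" for n x
  have intFt: "integrable lborel (\<lambda>x. F (x + c))" for c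
  proof (rule integrable_compact_support)
    show "continuous_on UNIV (\<lambda>x. F (x + c))"
      by (intro continuous_on_compose2[OF F(1)] continuous_intros) auto
    fix x :: 'a assume "norm x > R + norm c"
    then have "norm (x + c) > R" using norm_diff_ineq[of x c] by linarith
    then show "F (x + c) = 0" by (rule F(2))
  qed
  have D0: "(LINT x|lborel. D n x) = 0" for n
    unfolding D_def using integral_translation[of F "h n *\<^sub>R b"]
    by (simp add: Bochner_Integration.integral_diff intFt intF)
  have "bounded (F' ` cball 0 (R + 2))"
    by (intro compact_imp_bounded compact_continuous_image continuous_on_subset[OF contF']) auto
  then obtain M where "\<forall>v\<in>F' ` cball 0 (R + 2). norm v \<le> M"
    unfolding bounded_iff by blast
  then have M: "\<bar>F' x\<bar> \<le> M" if "norm x \<le> R + 2" for x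
    using that by auto
  have bound: "norm (D n x) \<le> indicator (cball 0 (R + 1)) x *\<^sub>R M" for n x
  proof (cases "norm x \<le> R + 1")
    case True
    have "\<exists>z>0. z < h n \<and> F (x + h n *\<^sub>R b) - F (x + 0 *\<^sub>R b) = (h n - 0) * F' (x + z *\<^sub>R b)"
      using h by (intro MVT2 has_partial_at[OF F']) auto
    then obtain z where z: "z > 0" "z < h n" "F (x + h n *\<^sub>R b) - F x = h n * F' (x + z *\<^sub>R b)" by auto
    have "norm (x + z *\<^sub>R b) \<le> norm x + norm (z *\<^sub>R b)" by (rule norm_triangle_ineq)
    also have "\<dots> \<le> R + 2" using True z h(2)[of n] b by simp
    finally have "\<bar>F' (x + z *\<^sub>R b)\<bar> \<le> M" by (rule M)
    then show ?thesis using True z h[of n] by (simp add: D_def)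
  next
    case False
    have "norm x - norm (h n *\<^sub>R b) \<le> norm (x + h n *\<^sub>R b)" by (rule norm_diff_ineq)
    then have "norm (x + h n *\<^sub>R b) > R" using False h[of n] b by simp
    then show ?thesis using F(2) False by (simp add: D_def)
  qed
  have "(\<lambda>n. LINT x|lborel. D n x) \<longlonglongrightarrow> (LINT x|lborel. F' x)"
  proof (rule integral_dominated_convergence)
    show "integrable lborel (\<lambda>x::'a. indicator (cball 0 (R + 1)) x *\<^sub>R M)"
      by (intro borel_integrable_compact) auto
    show "AE x in lborel. (\<lambda>n. D n x) \<longlonglongrightarrow> F' x"
    proof (rule AE_I2)
      fix x
      have "((\<lambda>t. F (x + t *\<^sub>R b)) has_real_derivative F' x) (at 0)"
        using F' unfolding has_partial_def by blast
      then have "((\<lambda>t. (F (x + t *\<^sub>R b) - F x) / t) \<longlongrightarrow> F' x) (at 0)"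
        by (simp add: DERIV_def)
      moreover have "filterlim h (at 0) sequentially"
        using h LIMSEQ_inverse_real_of_nat unfolding filterlim_at h_def by (auto intro!: always_eventually)
      ultimately show "(\<lambda>n. D n x) \<longlonglongrightarrow> F' x"
        unfolding D_def by (rule filterlim_compose)
    qed
    show "AE x in lborel. norm (D n x) \<le> indicator (cball 0 (R + 1)) x *\<^sub>R M" for n
      using bound by simp
  qed (auto simp: D_def)
  then show ?thesis using D0 by (simp add: LIMSEQ_const_iff)
qed

lemma integral_by_parts:
  fixes f g :: "'a::euclidean_space \<Rightarrow> real"
  assumes f: "continuous_on UNIV f" "\<And>x. norm x > R \<Longrightarrow> f x = 0" "has_partial f b f'"
    and g: "continuous_on UNIV g" "has_partial g b g'" and b: "norm b = 1" and R: "R \<ge> 0"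
  shows "(LINT x|lborel. f' x * g x) = - (LINT x|lborel. f x * g' x)"
proof -
  have c: "continuous_on UNIV f'" "continuous_on UNIV g'"
    using f(3) g(2) unfolding has_partial_def by auto
  have "(LINT x|lborel. f' x * g x + f x * g' x) = 0"
    using f g b R has_partial_mult[OF f(3) g(2) f(1) g(1)]
    by (intro integral_partial_zero[of "\<lambda>x. f x * g x" R b]) (auto intro!: continuous_intros)
  moreover have "integrable lborel (\<lambda>x. f' x * g x)"
    using has_partial_support[OF f(3,2)] c g
    by (intro integrable_compact_support[of _ R] continuous_intros) auto
  moreover have "integrable lborel (\<lambda>x. f x * g' x)"
    using f c by (intro integrable_compact_support[of _ R] continuous_intros) auto
  ultimately show ?thesis by (simp add: Bochner_Integration.integral_add)
qed

lemma integral_laplacian_symmetric: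
  fixes f u :: "'a::euclidean_space \<Rightarrow> real"
  assumes f: "continuous_on UNIV f" "\<And>x. norm x > R \<Longrightarrow> f x = 0" "has_laplacian f f'"
    and u: "continuous_on UNIV u" "has_laplacian u u'" and R: "R \<ge> 0"
  shows "(LINT x|lborel. f' x * u x) = (LINT x|lborel. f x * u' x)"
proof -
  obtain f1 f2 where F: "\<And>b. b \<in> Basis \<Longrightarrow> has_partial f b (f1 b)" "\<And>b. b \<in> Basis \<Longrightarrow> has_partial (f1 b) b (f2 b)"
    and f': "f' = (\<lambda>x. \<Sum>b\<in>Basis. f2 b x)"
    using f(3) unfolding has_laplacian_def by blast
  obtain u1 u2 where U: "\<And>b. b \<in> Basis \<Longrightarrow> has_partial u b (u1 b)" "\<And>b. b \<in> Basis \<Longrightarrow> has_partial (u1 b) b (u2 b)"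
    and u': "u' = (\<lambda>x. \<Sum>b\<in>Basis. u2 b x)"
    using u(2) unfolding has_laplacian_def by blast
  have c: "continuous_on UNIV (f1 b)" "continuous_on UNIV (f2 b)" "continuous_on UNIV (u1 b)" "continuous_on UNIV (u2 b)"
    if "b \<in> Basis" for b
    using F[OF that] U[OF that] unfolding has_partial_def by auto
  have s1: "f1 b x = 0" if "b \<in> Basis" "norm x > R" for b x
    using has_partial_support[OF F(1)[OF that(1)] f(2) that(2)] .
  have s2: "f2 b x = 0" if "b \<in> Basis" "norm x > R" for b x
    using has_partial_support[OF F(2)[OF that(1)] s1[OF that(1)] that(2)] .
  have i1: "integrable lborel (\<lambda>x. f2 b x * u x)" if "b \<in> Basis" for b
    using c[OF that] s2[OF that] u(1) by (intro integrable_compact_support[of _ R] continuous_intros) auto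
  have i2: "integrable lborel (\<lambda>x. f x * u2 b x)" if "b \<in> Basis" for b
    using c[OF that] f by (intro integrable_compact_support[of _ R] continuous_intros) auto
  have eq: "(LINT x|lborel. f2 b x * u x) = (LINT x|lborel. f x * u2 b x)" if b: "b \<in> Basis" for b
  proof -
    have "(LINT x|lborel. f2 b x * u x) = - (LINT x|lborel. f1 b x * u1 b x)"
      using b by (intro integral_by_parts[OF c(1)[OF b] s1[OF b] F(2)[OF b] u(1) U(1)[OF b] _ R]) auto
    also have "(LINT x|lborel. f1 b x * u1 b x) = - (LINT x|lborel. f x * u2 b x)"
      using b by (intro integral_by_parts[OF f(1,2) F(1)[OF b] c(3)[OF b] U(2)[OF b] _ R]) auto
    finally show ?thesis by simp
  qed
  have "(LINT x|lborel. f' x * u x) = (\<Sum>b\<in>Basis. LINT x|lborel. f2 b x * u x)"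
    unfolding f' sum_distrib_right by (intro Bochner_Integration.integral_sum i1)
  also have "\<dots> = (\<Sum>b\<in>Basis. LINT x|lborel. f x * u2 b x)"
    by (intro sum.cong refl eq)
  also have "\<dots> = (LINT x|lborel. f x * u' x)"
    unfolding u' sum_distrib_left by (intro Bochner_Integration.integral_sum[symmetric] i2)
  finally show ?thesis .
qed

lemma has_laplacian_support:
  assumes "has_laplacian f f'" "\<And>x. norm x > R \<Longrightarrow> f x = 0" "norm x > R"
  shows "f' x = 0"
proof -
  obtain f1 f2 where F: "\<And>b. b \<in> Basis \<Longrightarrow> has_partial f b (f1 b)" "\<And>b. b \<in> Basis \<Longrightarrow> has_partial (f1 b) b (f2 b)"
    and f': "f' = (\<lambda>x. \<Sum>b\<in>Basis. f2 b x)"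
    using assms(1) unfolding has_laplacian_def by blast
  have "f2 b x = 0" if "b \<in> Basis" for b
    using has_partial_support[OF F(2)[OF that] has_partial_support[OF F(1)[OF that] assms(2)] assms(3)] .
  then show ?thesis by (simp add: f')
qed

lemma has_laplacian_continuous:
  assumes "has_laplacian f f'"
  shows "continuous_on UNIV f'"
  using assms unfolding has_laplacian_def has_partial_def by (auto intro!: continuous_intros)

lemma iterated_laplacian_continuous_support:
  assumes f: "continuous_on UNIV (f 0)" "\<And>x. norm x > R \<Longrightarrow> f 0 x = 0"
      "\<And>j. j < k \<Longrightarrow> has_laplacian (f j) (f (Suc j))"
    and "j \<le> k"
  shows "continuous_on UNIV (f j)" "\<And>x. norm x > R \<Longrightarrow> f j x = 0"
proof -
  have "continuous_on UNIV (f j) \<and> (\<forall>x. norm x > R \<longrightarrow> f j x = 0)"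
    using \<open>j \<le> k\<close>
  proof (induction j)
    case (Suc j)
    then show ?case
      using has_laplacian_continuous[OF f(3)] has_laplacian_support[OF f(3), of j R] by auto
  qed (use f in auto)
  then show "continuous_on UNIV (f j)" "\<And>x. norm x > R \<Longrightarrow> f j x = 0" by auto
qed

lemma integral_iterated_laplacian:
  fixes f u :: "nat \<Rightarrow> 'a::euclidean_space \<Rightarrow> real"
  assumes f: "continuous_on UNIV (f 0)" "\<And>x. norm x > R \<Longrightarrow> f 0 x = 0"
      "\<And>j. j < k \<Longrightarrow> has_laplacian (f j) (f (Suc j))"
    and u: "continuous_on UNIV (u 0)" "\<And>j. j < k \<Longrightarrow> has_laplacian (u j) (u (Suc j))"
    and R: "R \<ge> 0"
  shows "(LINT x|lborel. f k x * u 0 x) = (LINT x|lborel. f 0 x * u k x)"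
proof -
  have F: "continuous_on UNIV (f j)" "\<And>x. norm x > R \<Longrightarrow> f j x = 0" if "j \<le> k" for j
    using iterated_laplacian_continuous_support[of f R k, OF f that] by blast+
  have U: "continuous_on UNIV (u j)" if "j \<le> k" for j
    using that u has_laplacian_continuous[OF u(2)] by (cases j) auto
  have "(LINT x|lborel. f k x * u 0 x) = (LINT x|lborel. f (k - i) x * u i x)" if "i \<le> k" for i
    using that
  proof (induction i)
    case (Suc i)
    have "(LINT x|lborel. f (Suc (k - Suc i)) x * u i x) = (LINT x|lborel. f (k - Suc i) x * u (Suc i) x)"
      using F[of "k - Suc i"] U[of i] Suc.prems R
      by (intro integral_laplacian_symmetric[of _ R] f(3) u(2)) auto
    moreover have "Suc (k - Suc i) = k - i" using Suc.prems by simp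
    ultimately show ?case using Suc by simp
  qed simp
  from this[of k] show ?thesis by simp
qed

lemma radial_has_laplacian:
  fixes x :: "'a::euclidean_space"
  assumes e: "e > 0"
    and u: "\<And>q. q > 0 \<Longrightarrow> (u has_real_derivative u' q) (at q)"
    and u': "\<And>q. q > 0 \<Longrightarrow> (u' has_real_derivative u'' q) (at q)"
    and cont: "continuous_on {0<..} u'" "continuous_on {0<..} u''"
  shows "has_laplacian (\<lambda>y. u ((norm (y - x))\<^sup>2 + e))
    (\<lambda>y. 2 * real DIM('a) * u' ((norm (y - x))\<^sup>2 + e)
       + 4 * (norm (y - x))\<^sup>2 * u'' ((norm (y - x))\<^sup>2 + e))"
proof -
  define Q where "Q y = (norm (y - x))\<^sup>2 + e" for y
  have Qpos: "Q y > 0" for y using e by (simp add: Q_def add_nonneg_pos)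
  have cQ: "continuous_on UNIV Q" unfolding Q_def by (intro continuous_intros)
  have cu: "continuous_on UNIV (\<lambda>y. u' (Q y))" "continuous_on UNIV (\<lambda>y. u'' (Q y))"
    using Qpos by (auto intro!: continuous_on_compose2[OF cont(1) cQ] continuous_on_compose2[OF cont(2) cQ])
  have dQ: "((\<lambda>t. Q (y + t *\<^sub>R b)) has_real_derivative 2 * ((y - x) \<bullet> b)) (at 0)" for y b
  proof -
    have "Q (y + t *\<^sub>R b) = (norm (y - x))\<^sup>2 + 2 * t * ((y - x) \<bullet> b) + t\<^sup>2 * (norm b)\<^sup>2 + e" for t
      unfolding Q_def power2_norm_eq_inner
      by (simp add: inner_simps inner_commute algebra_simps power2_eq_square)
    then show ?thesis by (auto intro!: derivative_eq_intros)
  qed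
  have d1: "has_partial (\<lambda>y. u (Q y)) b (\<lambda>y. 2 * ((y - x) \<bullet> b) * u' (Q y))" for b
    unfolding has_partial_def
  proof (intro conjI allI)
    show "continuous_on UNIV (\<lambda>y. 2 * ((y - x) \<bullet> b) * u' (Q y))"
      by (intro continuous_intros cu)
    fix y
    show "((\<lambda>t. u (Q (y + t *\<^sub>R b))) has_real_derivative 2 * ((y - x) \<bullet> b) * u' (Q y)) (at 0)"
      using DERIV_chain2[OF _ dQ[of y b], of u "u' (Q y)"] u[OF Qpos] by (simp add: mult.commute)
  qed
  have d2: "has_partial (\<lambda>y. 2 * ((y - x) \<bullet> b) * u' (Q y)) b
      (\<lambda>y. 2 * u' (Q y) + 4 * ((y - x) \<bullet> b)\<^sup>2 * u'' (Q y))" if b: "b \<in> Basis" for b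
    unfolding has_partial_def
  proof (intro conjI allI)
    show "continuous_on UNIV (\<lambda>y. 2 * u' (Q y) + 4 * ((y - x) \<bullet> b)\<^sup>2 * u'' (Q y))"
      by (intro continuous_intros cu)
    fix y
    have 1: "((\<lambda>t. u' (Q (y + t *\<^sub>R b))) has_real_derivative u'' (Q y) * (2 * ((y - x) \<bullet> b))) (at 0)"
      using DERIV_chain2[OF _ dQ[of y b], of u' "u'' (Q y)"] u'[OF Qpos] by simp
    have 2: "((\<lambda>t. 2 * ((y + t *\<^sub>R b - x) \<bullet> b)) has_real_derivative 2) (at 0)"
      using b by (auto simp: inner_simps intro!: derivative_eq_intros)
    show "((\<lambda>t. 2 * ((y + t *\<^sub>R b - x) \<bullet> b) * u' (Q (y + t *\<^sub>R b))) has_real_derivative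
        2 * u' (Q y) + 4 * ((y - x) \<bullet> b)\<^sup>2 * u'' (Q y)) (at 0)"
      using DERIV_mult[OF 2 1] by (simp add: power2_eq_square algebra_simps)
  qed
  have "(\<Sum>b\<in>Basis. 2 * u' (Q y) + 4 * ((y - x) \<bullet> b)\<^sup>2 * u'' (Q y))
      = 2 * real DIM('a) * u' (Q y) + 4 * (norm (y - x))\<^sup>2 * u'' (Q y)" for y
  proof -
    have "(norm (y - x))\<^sup>2 = (\<Sum>b\<in>Basis. ((y - x) \<bullet> b)\<^sup>2)"
      unfolding power2_norm_eq_inner by (subst euclidean_inner) (simp add: power2_eq_square)
    then show ?thesis by (simp add: sum.distrib sum_distrib_left sum_distrib_right)
  qed
  then show ?thesis
    using d1 d2 unfolding has_laplacian_def Q_def[symmetric]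
    by (intro exI[of _ "\<lambda>b y. 2 * ((y - x) \<bullet> b) * u' (Q y)"]
        exI[of _ "\<lambda>b y. 2 * u' (Q y) + 4 * ((y - x) \<bullet> b)\<^sup>2 * u'' (Q y)"]) auto
qed

section \<open>The fundamental solution property\<close>

text \<open>
  By symmetry twice the integral over the half-line, which the arctangent evaluates.
\<close>
lemma nn_integral_inverse_square_finite:
  "(\<integral>\<^sup>+x. ennreal (1 / (1 + (x::real)\<^sup>2)) \<partial>lborel) < \<infinity>"
proof -
  let ?f = "\<lambda>x::real. 1 / (1 + x\<^sup>2)"
  have pos: "1 + x\<^sup>2 > 0" for x :: real by (simp add: add_pos_nonneg)
  have half: "(\<integral>\<^sup>+x. ennreal (?f x) * indicator {0..} x \<partial>lborel) = ennreal (pi / 2 - arctan 0)"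
    by (rule nn_integral_FTC_atLeast)
       (auto intro!: derivative_eq_intros tendsto_arctan_at_top less_imp_le[OF pos] simp: field_simps)
  have "(\<integral>\<^sup>+x. ennreal (?f x) \<partial>lborel)
      \<le> (\<integral>\<^sup>+x. ennreal (?f x) * indicator {0..} x + ennreal (?f x) * indicator {0..} (- x) \<partial>lborel)"
    by (intro nn_integral_mono) (auto simp: indicator_def)
  also have "\<dots> = (\<integral>\<^sup>+x. ennreal (?f x) * indicator {0..} x \<partial>lborel)
      + (\<integral>\<^sup>+x. ennreal (?f x) * indicator {0..} (- x) \<partial>lborel)"
    by (intro nn_integral_add) auto
  also have "(\<integral>\<^sup>+x. ennreal (?f x) * indicator {0..} (- x) \<partial>lborel)
      = (\<integral>\<^sup>+x. ennreal (?f x) * indicator {0..} x \<partial>lborel)"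
    by (subst (2) nn_integral_real_affine[where c = "-1" and t = 0]) auto
  finally show ?thesis unfolding half by (simp add: ennreal_plus[symmetric] del: ennreal_plus) (metis order_le_less_trans ennreal_less_top top.not_eq_extremum)
qed

text \<open>
  Since \<open>1 + |z|\<^sup>2 \<ge> 1 + z\<^sub>b\<^sup>2\<close> for each coordinate, the function is dominated by the product of the
  integrable one-dimensional functions \<open>1 / (1 + z\<^sub>b\<^sup>2)\<close>, which Tonelli's theorem integrates separately.
\<close>
lemma integrable_bessel_type_kernel:
  assumes "r \<ge> real DIM('a)"
  shows "integrable lborel (\<lambda>z::'a::euclidean_space. (1 + (norm z)\<^sup>2) powr (- r))"
proof (rule integrableI_bounded)
  show "(\<lambda>z::'a. (1 + (norm z)\<^sup>2) powr (- r)) \<in> borel_measurable lborel" by measurable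
  let ?f = "\<lambda>x::real. 1 / (1 + x\<^sup>2)"
  have f0: "?f x \<ge> 0" for x by (simp add: add_nonneg_nonneg)
  have bound: "(1 + (norm z)\<^sup>2) powr (- r) \<le> (\<Prod>b\<in>Basis. ?f (z \<bullet> b))" for z :: 'a
  proof -
    let ?A = "1 + (norm z)\<^sup>2"
    have A: "?A \<ge> 1" by simp
    have "?A powr (- r) \<le> ?A powr (- real DIM('a))"
      using assms A by (intro powr_mono) auto
    also have "\<dots> = (\<Prod>b\<in>(Basis::'a set). 1 / ?A)"
      using A by (simp add: powr_minus powr_realpow add_pos_nonneg power_divide field_simps)
    also have "\<dots> \<le> (\<Prod>b\<in>Basis. ?f (z \<bullet> b))"
    proof (rule prod_mono)
      fix b :: 'a assume "b \<in> Basis"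
      then have "(z \<bullet> b)\<^sup>2 \<le> (norm z)\<^sup>2" using Basis_le_norm[of b z] by (simp add: abs_le_square_iff[symmetric])
      then show "0 \<le> 1 / ?A \<and> 1 / ?A \<le> ?f (z \<bullet> b)"
        by (auto intro!: divide_left_mono mult_pos_pos add_pos_nonneg)
    qed
    finally show ?thesis .
  qed
  have "(\<integral>\<^sup>+z. ennreal (norm ((1 + (norm (z::'a))\<^sup>2) powr (- r))) \<partial>lborel)
      \<le> (\<integral>\<^sup>+z. (\<Prod>b\<in>Basis. ennreal (?f ((z::'a) \<bullet> b))) \<partial>lborel)"
    using bound by (intro nn_integral_mono) (simp add: prod_ennreal f0 ennreal_leI)
  also have "\<dots> = (\<Prod>b\<in>(Basis::'a set). \<integral>\<^sup>+x. ennreal (?f x) \<partial>lborel)"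
    by (rule nn_integral_lborel_prod) auto
  also have "\<dots> < \<infinity>"
    using nn_integral_inverse_square_finite by (simp add: power_less_top_ennreal)
  finally show "(\<integral>\<^sup>+z. ennreal (norm ((1 + (norm (z::'a))\<^sup>2) powr (- r))) \<partial>lborel) < \<infinity>" .
qed

lemma integral_affine:
  fixes g :: "'a::euclidean_space \<Rightarrow> real"
  assumes [measurable]: "g \<in> borel_measurable borel" and c: "c > 0"
  shows "(LINT y|lborel. g y) = c ^ DIM('a) * (LINT z|lborel. g (x + c *\<^sub>R z))"
proof -
  have "(LINT y|lborel. g y)
      = (LINT y|density (distr lborel borel (\<lambda>z. x + c *\<^sub>R z)) (\<lambda>_. ennreal (\<bar>c\<bar> ^ DIM('a))). g y)"
    using lborel_affine[of c x] c by simp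
  also have "\<dots> = (LINT y|distr lborel borel (\<lambda>z. x + c *\<^sub>R z). \<bar>c\<bar> ^ DIM('a) * g y)"
    by (subst integral_density) auto
  also have "\<dots> = c ^ DIM('a) * (LINT z|lborel. g (x + c *\<^sub>R z))"
    using c by (subst integral_distr) auto
  finally show ?thesis .
qed

text \<open>
  The value at \<open>0\<close> is \<open>0\<close> because \<open>0 powr s = 0\<close>, and it is the limit since \<open>s > 0\<close> beats the logarithm.
\<close>
lemma profile_continuous_at_0:
  assumes "s > 0"
  shows "continuous_on {0..} (profile \<alpha> \<beta> s 1 0)"
proof -
  have powr0: "((\<lambda>q. q powr a) \<longlongrightarrow> (0::real)) (at_right 0)" if "a > 0" for a :: real
    using that by (intro tendsto_zero_powrI[where b = a]) (auto simp: eventually_at_right_less less_imp_le eventually_at_filter)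
  have "((\<lambda>q::real. ln q * q powr s) \<longlongrightarrow> 0) (at_right 0)"
  proof (rule Lim_null_comparison)
    show "((\<lambda>q. (2 / s) * q powr (s / 2)) \<longlongrightarrow> 0) (at_right 0)"
      using tendsto_mult_left[OF powr0[of "s / 2"], of "2 / s"] assms by simp
    have "norm (ln q * q powr s) \<le> 2 / s * q powr (s / 2)" if q: "q > 0" "q < 1" for q
    proof -
      \<comment> \<open>Half of the power \<open>q powr s\<close> absorbs the logarithm.\<close>
      have "ln (1 / q) \<le> (1 / q) powr (s / 2) / (s / 2)"
        using q assms by (intro ln_powr_bound) auto
      then have "\<bar>ln q\<bar> \<le> 2 / s * q powr (- (s / 2))"
        using q by (simp add: ln_div powr_divide powr_minus field_simps)
      then have "\<bar>ln q\<bar> * q powr s \<le> 2 / s * q powr (- (s / 2)) * q powr s"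
        by (rule mult_right_mono) simp
      also have "\<dots> = 2 / s * q powr (s / 2)"
        by (simp add: powr_add[symmetric])
      finally show ?thesis by (simp add: abs_mult)
    qed
    then show "\<forall>\<^sub>F q in at_right 0. norm (ln q * q powr s) \<le> 2 / s * q powr (s / 2)"
      unfolding eventually_at_right_field by (intro exI[of _ 1]) auto
  qed
  from tendsto_add[OF tendsto_mult_left[OF powr0[OF assms], of \<alpha>] tendsto_mult_left[OF this, of \<beta>]]
  have "((\<lambda>q::real. (\<alpha> + \<beta> * ln q) * q powr s) \<longlongrightarrow> 0) (at_right 0)"
    by (simp add: algebra_simps)
  then have "((\<lambda>q. profile \<alpha> \<beta> s 1 0 q) \<longlongrightarrow> profile \<alpha> \<beta> s 1 0 0) (at_right 0)"
    by (simp add: profile_def pderiv_1)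
  then have "(profile \<alpha> \<beta> s 1 0 \<longlongrightarrow> profile \<alpha> \<beta> s 1 0 0) (at 0 within {0..})"
    by (simp add: at_within_Ici_at_right)
  moreover have "(profile \<alpha> \<beta> s 1 0 \<longlongrightarrow> profile \<alpha> \<beta> s 1 0 q) (at q within {0..})" if "q > 0" for q
    using profile_continuous[of \<alpha> \<beta> s 1 0] that
    by (meson continuous_on_eq_continuous_at continuous_at open_greaterThan greaterThan_iff isContD tendsto_within_subset top_greatest Lim_at_imp_Lim_at_within)
  ultimately show ?thesis
    unfolding continuous_on_def by (metis atLeast_iff order_le_less)
qed

lemma laplace_profile_has_laplacian:
  fixes x :: "'a::euclidean_space"
  assumes e: "e > 0"
  defines "D \<equiv> real DIM('a)"
  shows "has_laplacian (\<lambda>y. laplace_profile \<alpha> \<beta> s D e j ((norm (y - x))\<^sup>2 + e))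
           (\<lambda>y. laplace_profile \<alpha> \<beta> s D e (Suc j) ((norm (y - x))\<^sup>2 + e))"
proof -
  have "laplace_profile \<alpha> \<beta> s D e (Suc j) ((norm (y - x))\<^sup>2 + e)
      = 2 * D * laplace_profile' \<alpha> \<beta> s D e j ((norm (y - x))\<^sup>2 + e)
       + 4 * (norm (y - x))\<^sup>2 * laplace_profile'' \<alpha> \<beta> s D e j ((norm (y - x))\<^sup>2 + e)" for y
    using laplace_profile_Suc[of "(norm (y - x))\<^sup>2 + e" D \<alpha> \<beta> s e j] e by (simp add: add_nonneg_pos)
  then show ?thesis
    using radial_has_laplacian[OF e laplace_profile_derivatives(1) laplace_profile_derivatives(2)
        laplace_profile_continuous(2,3), of \<alpha> \<beta> s D e j x]
    unfolding D_def by simp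
qed

text \<open>
  All \<open>k\<close> Laplacians are moved from \<open>f\<close> to the smooth kernel, where they produce \<open>\<kappa> \<epsilon>\<^sup>2\<^sup>k (|y - x|\<^sup>2 + \<epsilon>\<^sup>2)\<^sup>s\<^sup>-\<^sup>2\<^sup>k\<close>.
  After the substitution \<open>y = x + \<epsilon> z\<close> the powers of \<open>\<epsilon>\<close> cancel, because
  \<open>d + 2 k + 2 (s - 2 k) = 0\<close>.
\<close>
lemma regularized_representation:
  fixes f :: "nat \<Rightarrow> 'a::euclidean_space \<Rightarrow> real"
  assumes f: "continuous_on UNIV (f 0)" "\<And>x. norm x > R \<Longrightarrow> f 0 x = 0"
      "\<And>j. j < k \<Longrightarrow> has_laplacian (f j) (f (Suc j))"
    and R: "R \<ge> 0" and \<epsilon>: "\<epsilon> > 0"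
    and s: "s + real DIM('a) / 2 = real k"
    and \<kappa>: "\<And>e q. q > 0 \<Longrightarrow>
       laplace_profile \<alpha> \<beta> s (real DIM('a)) e k q = \<kappa> * e ^ k * q powr (s - 2 * real k)"
  shows "(LINT y|lborel. f k y * profile \<alpha> \<beta> s 1 0 ((norm (y - x))\<^sup>2 + \<epsilon>\<^sup>2))
     = \<kappa> * (LINT z|lborel. f 0 (x + \<epsilon> *\<^sub>R z) * (1 + (norm z)\<^sup>2) powr (s - 2 * real k))"
proof -
  define D where "D = real DIM('a)"
  have pos: "(norm (y - x))\<^sup>2 + \<epsilon>\<^sup>2 > 0" for y :: 'a using \<epsilon> by (simp add: add_nonneg_pos)
  define u where "u j y = laplace_profile \<alpha> \<beta> s D (\<epsilon>\<^sup>2) j ((norm (y - x))\<^sup>2 + \<epsilon>\<^sup>2)" for j y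
  have u0: "u 0 y = profile \<alpha> \<beta> s 1 0 ((norm (y - x))\<^sup>2 + \<epsilon>\<^sup>2)" for y
    by (simp add: u_def laplace_profile_0)
  have cu: "continuous_on UNIV (u 0)"
    unfolding u_def using pos
    by (intro continuous_on_compose2[OF laplace_profile_continuous(1)] continuous_intros) auto
  have "(LINT y|lborel. f k y * u 0 y) = (LINT y|lborel. f 0 y * u k y)"
    using f R cu laplace_profile_has_laplacian[of "\<epsilon>\<^sup>2" \<alpha> \<beta> s _ x] \<epsilon>
    by (intro integral_iterated_laplacian[of f R k u]) (auto simp: u_def[abs_def] D_def)
  also have "u k y = \<kappa> * (\<epsilon>\<^sup>2) ^ k * ((norm (y - x))\<^sup>2 + \<epsilon>\<^sup>2) powr (s - 2 * real k)" for y
    unfolding u_def D_def by (rule \<kappa>[OF pos])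
  then have "(LINT y|lborel. f 0 y * u k y)
      = (LINT y|lborel. f 0 y * (\<kappa> * (\<epsilon>\<^sup>2) ^ k * ((norm (y - x))\<^sup>2 + \<epsilon>\<^sup>2) powr (s - 2 * real k)))"
    by simp
  also have "\<dots> = \<epsilon> ^ DIM('a) * (LINT z|lborel. f 0 (x + \<epsilon> *\<^sub>R z) *
      (\<kappa> * (\<epsilon>\<^sup>2) ^ k * ((norm (x + \<epsilon> *\<^sub>R z - x))\<^sup>2 + \<epsilon>\<^sup>2) powr (s - 2 * real k)))"
  proof (rule integral_affine[OF _ \<epsilon>])
    have [measurable]: "f 0 \<in> borel_measurable borel"
      using f(1) by (rule borel_measurable_continuous_onI)
    show "(\<lambda>y. f 0 y * (\<kappa> * (\<epsilon>\<^sup>2) ^ k * ((norm (y - x))\<^sup>2 + \<epsilon>\<^sup>2) powr (s - 2 * real k))) \<in> borel_measurable borel"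
      by measurable
  qed
  also have "\<dots> = (LINT z|lborel. \<kappa> * (f 0 (x + \<epsilon> *\<^sub>R z) * (1 + (norm z)\<^sup>2) powr (s - 2 * real k)))"
  proof -
    have "\<epsilon> ^ DIM('a) * (\<epsilon>\<^sup>2) ^ k * ((norm (x + \<epsilon> *\<^sub>R z - x))\<^sup>2 + \<epsilon>\<^sup>2) powr (s - 2 * real k)
        = (1 + (norm z)\<^sup>2) powr (s - 2 * real k)" for z :: 'a
    proof -
      have scale: "(norm (x + \<epsilon> *\<^sub>R z - x))\<^sup>2 + \<epsilon>\<^sup>2 = \<epsilon>\<^sup>2 * (1 + (norm z)\<^sup>2)"
        using \<epsilon> by (simp add: power_mult_distrib algebra_simps)
      have split: "(\<epsilon>\<^sup>2 * (1 + (norm z)\<^sup>2)) powr (s - 2 * real k)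
          = (\<epsilon>\<^sup>2) powr (s - 2 * real k) * (1 + (norm z)\<^sup>2) powr (s - 2 * real k)"
        by (rule powr_mult)
      have cancel: "\<epsilon> ^ DIM('a) * (\<epsilon>\<^sup>2) ^ k * (\<epsilon>\<^sup>2) powr (s - 2 * real k) = 1"
      proof -
        have "(\<epsilon>\<^sup>2) ^ k = \<epsilon> powr (2 * real k)"
          using powr_realpow[OF \<epsilon>, of "2 * k"] by (simp add: power_mult)
        moreover have "(\<epsilon>\<^sup>2) powr a = \<epsilon> powr (2 * a)" for a
          using powr_powr[of \<epsilon> 2 a] powr_realpow[OF \<epsilon>, of 2] by simp
        moreover have "\<epsilon> ^ DIM('a) = \<epsilon> powr real DIM('a)"
          using powr_realpow[OF \<epsilon>, of "DIM('a)"] by simp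
        ultimately have pw: "(\<epsilon>\<^sup>2) ^ k = \<epsilon> powr (2 * real k)" "\<And>a. (\<epsilon>\<^sup>2) powr a = \<epsilon> powr (2 * a)"
          "\<epsilon> ^ DIM('a) = \<epsilon> powr real DIM('a)" by blast+
        have "\<epsilon> ^ DIM('a) * (\<epsilon>\<^sup>2) ^ k * (\<epsilon>\<^sup>2) powr (s - 2 * real k)
            = \<epsilon> powr real DIM('a) * \<epsilon> powr (2 * real k) * \<epsilon> powr (2 * (s - 2 * real k))"
          by (simp only: pw)
        also have "\<dots> = \<epsilon> powr (real DIM('a) + 2 * real k + 2 * (s - 2 * real k))"
          by (simp only: powr_add)
        also have "real DIM('a) + 2 * real k + 2 * (s - 2 * real k) = 0" using s by simp
        finally show ?thesis using \<epsilon> by simp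
      qed
      show ?thesis unfolding scale split
        by (simp only: mult.assoc[symmetric] cancel mult_1_left)
    qed
    moreover have "a * (b * (c * d * g)) = c * (b * (a * d * g))" for a b c d g :: real
      by (simp only: mult_ac)
    ultimately have "\<epsilon> ^ DIM('a) * (f 0 (x + \<epsilon> *\<^sub>R z) *
      (\<kappa> * (\<epsilon>\<^sup>2) ^ k * ((norm (x + \<epsilon> *\<^sub>R z - x))\<^sup>2 + \<epsilon>\<^sup>2) powr (s - 2 * real k)))
      = \<kappa> * (f 0 (x + \<epsilon> *\<^sub>R z) * (1 + (norm z)\<^sup>2) powr (s - 2 * real k))" for z
      by presburger
    then show ?thesis by (subst integral_mult_right_zero[symmetric]) (simp only:)
  qed
  finally show ?thesis unfolding u0 by simp
qed

text \<open>
  Let \<open>\<epsilon> \<rightarrow> 0\<close> in the regularized identity. Dominated convergence applies on both sides: on the left over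
  the compact support of \<open>\<Delta>\<^sup>k f\<close>, on the right because \<open>(1 + |z|\<^sup>2)\<^sup>s\<^sup>-\<^sup>2\<^sup>k\<close> is integrable. Its integral is positive
  and, multiplied by \<open>\<kappa>\<close>, gives the constant \<open>C\<close>.
\<close>
lemma polyharmonic_representation:
  fixes f :: "nat \<Rightarrow> 'a::euclidean_space \<Rightarrow> real"
  assumes f: "continuous_on UNIV (f 0)" "\<And>x. norm x > R \<Longrightarrow> f 0 x = 0"
      "\<And>j. j < k \<Longrightarrow> has_laplacian (f j) (f (Suc j))"
    and R: "R \<ge> 0" and par: "spline_parameters \<alpha> \<beta> s"
    and s: "s + real DIM('a) / 2 = real k"
  obtains C where "C \<noteq> 0"
    "\<And>x. (LINT y|lborel. f k y * profile \<alpha> \<beta> s 1 0 ((norm (y - x))\<^sup>2)) = C * f 0 x"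
proof -
  have s0: "s > 0" using par by (simp add: spline_parameters_def)
  obtain \<kappa> where \<kappa>: "\<kappa> \<noteq> 0" "\<And>e q. q > 0 \<Longrightarrow>
       laplace_profile \<alpha> \<beta> s (real DIM('a)) e k q = \<kappa> * e ^ k * q powr (s - 2 * real k)"
    using laplace_profile_top[OF par s] by auto
  define w where "w z = (1 + (norm z)\<^sup>2) powr (s - 2 * real k)" for z :: 'a
  have w: "integrable lborel w"
    using integrable_bessel_type_kernel[where 'a = 'a, of "2 * real k - s"] s s0 by (simp add: w_def[abs_def])
  have wpos: "w z > 0" for z unfolding w_def by (simp add: add_pos_nonneg less_imp_neq[symmetric])
  have I: "(LINT z|lborel. w z) \<noteq> 0"
  proof
    assume "(LINT z|lborel. w z) = 0"
    then have "AE z in lborel. w z = 0"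
      using integral_nonneg_eq_0_iff_AE[OF w] less_imp_le[OF wpos] by auto
    then have "AE z::'a in lborel. False"
      using wpos by (auto simp: less_le elim: eventually_mono)
    then show False
      using AE_iff_measurable[of UNIV lborel "\<lambda>z::'a. False"] by simp
  qed
  have ball: "bounded (g ` cball 0 R)" if "continuous_on UNIV g" for g :: "'a \<Rightarrow> real"
    by (intro compact_imp_bounded compact_continuous_image continuous_on_subset[OF that]) auto
  have F: "continuous_on UNIV (f j)" "\<And>x. norm x > R \<Longrightarrow> f j x = 0" if "j \<le> k" for j
    using iterated_laplacian_continuous_support[of f R k, OF f that] by blast+
  have [measurable]: "f 0 \<in> borel_measurable borel" "f k \<in> borel_measurable borel" "w \<in> borel_measurable borel"
    using F[of 0] F[of k] w by (auto intro: borel_measurable_continuous_onI)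
  obtain M where "\<forall>v\<in>f 0 ` cball 0 R. norm v \<le> M" using ball[OF f(1)] unfolding bounded_iff by blast
  then have M: "\<bar>f 0 x\<bar> \<le> \<bar>M\<bar>" for x using f(2)[of x] by (cases "norm x \<le> R") force+
  obtain N where "\<forall>v\<in>f k ` cball 0 R. norm v \<le> N" using ball[of "f k"] F[of k] unfolding bounded_iff by blast
  then have N: "\<bar>f k x\<bar> \<le> \<bar>N\<bar> * indicator (cball 0 R) x" for x
  proof (cases "norm x \<le> R")
    case True
    then have "\<bar>f k x\<bar> \<le> N" using \<open>\<forall>v\<in>f k ` cball 0 R. norm v \<le> N\<close> by auto
    then show ?thesis using True by simp
  next
    case False
    then show ?thesis using F[of k] by simp
  qed
  define h where "h n = inverse (real (Suc n))" for n
  have h: "h n > 0" "h n \<le> 1" for n by (auto simp: h_def field_simps)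
  have h0: "h \<longlonglongrightarrow> 0" unfolding h_def by (rule LIMSEQ_inverse_real_of_nat)
  have "(LINT y|lborel. f k y * profile \<alpha> \<beta> s 1 0 ((norm (y - x))\<^sup>2)) = \<kappa> * (LINT z|lborel. w z) * f 0 x" for x
  proof -
    define T where "T = (R + norm x)\<^sup>2 + 1"
    have "bounded (profile \<alpha> \<beta> s 1 0 ` {0..T})"
      by (intro compact_imp_bounded compact_continuous_image continuous_on_subset[OF profile_continuous_at_0[OF s0]]) auto
    then obtain P where "\<forall>v\<in>profile \<alpha> \<beta> s 1 0 ` {0..T}. norm v \<le> P" unfolding bounded_iff by blast
    then have P: "\<bar>profile \<alpha> \<beta> s 1 0 q\<bar> \<le> \<bar>P\<bar>" if "0 \<le> q" "q \<le> T" for q using that by force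
    have mp: "(\<lambda>y. profile \<alpha> \<beta> s 1 0 ((norm (y - x))\<^sup>2 + c)) \<in> borel_measurable borel" if "c \<ge> 0" for c
      using that by (intro borel_measurable_continuous_onI
          continuous_on_compose2[OF profile_continuous_at_0[OF s0]] continuous_intros) auto
    have "(\<lambda>n. LINT y|lborel. f k y * profile \<alpha> \<beta> s 1 0 ((norm (y - x))\<^sup>2 + (h n)\<^sup>2))
        \<longlonglongrightarrow> (LINT y|lborel. f k y * profile \<alpha> \<beta> s 1 0 ((norm (y - x))\<^sup>2))"
    proof (rule integral_dominated_convergence)
      show "integrable lborel (\<lambda>y::'a. indicator (cball 0 R) y *\<^sub>R (\<bar>N\<bar> * \<bar>P\<bar>))"
        by (intro borel_integrable_compact) auto
      show "AE y in lborel. (\<lambda>n. f k y * profile \<alpha> \<beta> s 1 0 ((norm (y - x))\<^sup>2 + (h n)\<^sup>2))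
          \<longlonglongrightarrow> f k y * profile \<alpha> \<beta> s 1 0 ((norm (y - x))\<^sup>2)"
      proof (intro AE_I2 tendsto_mult tendsto_const)
        fix y
        have "(\<lambda>n. (norm (y - x))\<^sup>2 + (h n)\<^sup>2) \<longlonglongrightarrow> (norm (y - x))\<^sup>2 + 0\<^sup>2"
          by (intro tendsto_intros h0)
        then show "(\<lambda>n. profile \<alpha> \<beta> s 1 0 ((norm (y - x))\<^sup>2 + (h n)\<^sup>2)) \<longlonglongrightarrow> profile \<alpha> \<beta> s 1 0 ((norm (y - x))\<^sup>2)"
          by (intro continuous_on_tendsto_compose[OF profile_continuous_at_0[OF s0]]) auto
      qed
      show "AE y in lborel. norm (f k y * profile \<alpha> \<beta> s 1 0 ((norm (y - x))\<^sup>2 + (h n)\<^sup>2))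
          \<le> indicator (cball 0 R) y *\<^sub>R (\<bar>N\<bar> * \<bar>P\<bar>)" for n
      proof (rule AE_I2)
        fix y
        show "norm (f k y * profile \<alpha> \<beta> s 1 0 ((norm (y - x))\<^sup>2 + (h n)\<^sup>2))
          \<le> indicator (cball 0 R) y *\<^sub>R (\<bar>N\<bar> * \<bar>P\<bar>)"
        proof (cases "norm y \<le> R")
          case True
          have "norm (y - x) \<le> R + norm x" using norm_triangle_ineq4[of y x] True by simp
          then have "(norm (y - x))\<^sup>2 + (h n)\<^sup>2 \<le> T"
            unfolding T_def using h[of n] by (intro add_mono power_mono power_le_one) auto
          then have "\<bar>profile \<alpha> \<beta> s 1 0 ((norm (y - x))\<^sup>2 + (h n)\<^sup>2)\<bar> \<le> \<bar>P\<bar>" by (intro P) auto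
          then show ?thesis using N[of y] True by (auto simp: abs_mult intro!: mult_mono)
        next
          case False
          then show ?thesis using F[of k] by auto
        qed
      qed
      show "(\<lambda>y. f k y * profile \<alpha> \<beta> s 1 0 ((norm (y - x))\<^sup>2)) \<in> borel_measurable lborel"
        using mp[of 0] by auto
      show "(\<lambda>y. f k y * profile \<alpha> \<beta> s 1 0 ((norm (y - x))\<^sup>2 + (h n)\<^sup>2)) \<in> borel_measurable lborel" for n
        using mp[of "(h n)\<^sup>2"] by auto
    qed
    moreover have "(LINT y|lborel. f k y * profile \<alpha> \<beta> s 1 0 ((norm (y - x))\<^sup>2 + (h n)\<^sup>2))
        = \<kappa> * (LINT z|lborel. f 0 (x + h n *\<^sub>R z) * w z)" for n
      unfolding w_def by (rule regularized_representation[OF f R h(1) s \<kappa>(2)])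
    moreover have "(\<lambda>n. \<kappa> * (LINT z|lborel. f 0 (x + h n *\<^sub>R z) * w z)) \<longlonglongrightarrow> \<kappa> * (LINT z|lborel. f 0 x * w z)"
    proof (intro tendsto_mult tendsto_const, rule integral_dominated_convergence)
      show "integrable lborel (\<lambda>z. \<bar>M\<bar> * w z)" using w by simp
      show "AE z in lborel. (\<lambda>n. f 0 (x + h n *\<^sub>R z) * w z) \<longlonglongrightarrow> f 0 x * w z"
      proof (intro AE_I2 tendsto_mult tendsto_const)
        fix z
        have "(\<lambda>n. x + h n *\<^sub>R z) \<longlonglongrightarrow> x + 0 *\<^sub>R z" by (intro tendsto_intros h0)
        then show "(\<lambda>n. f 0 (x + h n *\<^sub>R z)) \<longlonglongrightarrow> f 0 x"
          by (intro continuous_on_tendsto_compose[OF f(1)]) auto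
      qed
      show "AE z in lborel. norm (f 0 (x + h n *\<^sub>R z) * w z) \<le> \<bar>M\<bar> * w z" for n
        using M less_imp_le[OF wpos] by (auto simp: abs_mult intro!: mult_mono)
    qed auto
    ultimately show ?thesis
      using LIMSEQ_unique by (auto simp: mult_ac)
  qed
  moreover have "\<kappa> * (LINT z|lborel. w z) \<noteq> 0" using \<kappa>(1) I by simp
  ultimately show thesis using that by blast
qed

section \<open>Functions vanishing near the sphere\<close>

text \<open>
  These functions vanish outside the unit ball, and differentiation only lowers the exponent \<open>m\<close> by one. They
  are flexible enough to approximate every continuous function that vanishes near the sphere.
\<close>
definition cutoff_poly :: "nat \<Rightarrow> ('a::euclidean_space \<Rightarrow> real) set" where
  "cutoff_poly m = {f. \<exists>p. real_polynomial_function p \<and> f = (\<lambda>x. max 0 (1 - (norm x)\<^sup>2) ^ m * p x)}"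

lemma real_polynomial_function_partial:
  fixes p :: "'a::euclidean_space \<Rightarrow> real"
  assumes "real_polynomial_function p"
  shows "\<exists>p'. real_polynomial_function p' \<and>
     (\<forall>x. ((\<lambda>t. p (x + t *\<^sub>R b)) has_real_derivative p' x) (at 0))"
  using assms
proof (induction rule: real_polynomial_function.induct)
  case (linear f)
  then have "((\<lambda>t. f (x + t *\<^sub>R b)) has_real_derivative f b) (at 0)" for x
    by (auto simp: linear_simps intro!: derivative_eq_intros)
  then show ?case by (intro exI[of _ "\<lambda>_. f b"]) (auto intro: real_polynomial_function.intros)
next
  case (const c)
  then show ?case by (intro exI[of _ "\<lambda>_. 0"]) (auto intro: real_polynomial_function.intros)
next
  case (add f g)
  then obtain f' g' where "real_polynomial_function f'" "real_polynomial_function g'"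
    "\<And>x. ((\<lambda>t. f (x + t *\<^sub>R b)) has_real_derivative f' x) (at 0)"
    "\<And>x. ((\<lambda>t. g (x + t *\<^sub>R b)) has_real_derivative g' x) (at 0)" by blast
  then show ?case
    by (intro exI[of _ "\<lambda>x. f' x + g' x"]) (auto intro: real_polynomial_function.intros DERIV_add)
next
  case (mult f g)
  then obtain f' g' where "real_polynomial_function f'" "real_polynomial_function g'"
    "\<And>x. ((\<lambda>t. f (x + t *\<^sub>R b)) has_real_derivative f' x) (at 0)"
    "\<And>x. ((\<lambda>t. g (x + t *\<^sub>R b)) has_real_derivative g' x) (at 0)" by blast
  then show ?case using mult.hyps
    by (intro exI[of _ "\<lambda>x. f' x * g x + g' x * f x"])
       (auto intro!: real_polynomial_function.intros(3,4) derivative_eq_intros)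
qed

lemma max_power_has_derivative:
  assumes "m \<ge> 1"
  shows "((\<lambda>q::real. max 0 q ^ Suc m) has_real_derivative real (Suc m) * max 0 q ^ m) (at q)"
proof -
  consider "q > 0" | "q < 0" | "q = 0" by linarith
  then show ?thesis
  proof cases
    case 1
    then have ev: "\<forall>\<^sub>F x in nhds q. max 0 x ^ Suc m = x ^ Suc m"
      using eventually_nhds_in_open[of "{0<..}" q] by (auto elim!: eventually_mono)
    have "((\<lambda>q::real. q ^ Suc m) has_real_derivative real (Suc m) * q ^ m) (at q)"
      by (auto intro!: derivative_eq_intros simp del: power_Suc)
    then show ?thesis using DERIV_cong_ev[OF refl ev refl] 1 by (simp add: max_def)
  next
    case 2
    then have ev: "\<forall>\<^sub>F x in nhds q. max 0 x ^ Suc m = 0"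
      using eventually_nhds_in_open[of "{..<0}" q] by (auto elim!: eventually_mono)
    have "((\<lambda>q::real. 0::real) has_real_derivative 0) (at q)" by simp
    then show ?thesis using DERIV_cong_ev[OF refl ev refl] 2 assms by (simp add: power_0_left)
  next
    case 3
    have "((\<lambda>h::real. max 0 h ^ Suc m / h) \<longlongrightarrow> 0) (at 0)"
    proof (rule Lim_null_comparison)
      show "\<forall>\<^sub>F h in at 0. norm (max 0 h ^ Suc m / h) \<le> \<bar>h\<bar> ^ m"
        by (auto simp: max_def abs_mult power_abs)
      have "((\<lambda>h::real. \<bar>h\<bar> ^ m) \<longlongrightarrow> \<bar>0\<bar> ^ m) (at 0)" by (intro tendsto_intros)
      then show "((\<lambda>h::real. \<bar>h\<bar> ^ m) \<longlongrightarrow> 0) (at 0)" using assms by (simp add: power_0_left)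
    qed
    then show ?thesis using 3 assms by (simp add: DERIV_def power_0_left)
  qed
qed

lemma continuous_cutoff_poly:
  assumes "f \<in> cutoff_poly m"
  shows "continuous_on UNIV f"
proof -
  obtain p where p: "real_polynomial_function p" "f = (\<lambda>x. max 0 (1 - (norm x)\<^sup>2) ^ m * p x)"
    using assms unfolding cutoff_poly_def by blast
  have "continuous_on UNIV p"
    using p(1) by (intro continuous_on_polymonial_function) (simp add: real_polynomial_function_eq)
  then show ?thesis unfolding p(2) by (intro continuous_intros)
qed

lemma cutoff_poly_sum:
  assumes "\<And>i. i \<in> I \<Longrightarrow> f i \<in> cutoff_poly m"
  shows "(\<lambda>x. \<Sum>i\<in>I. f i x) \<in> cutoff_poly m"
proof -
  obtain p where p: "\<And>i. i \<in> I \<Longrightarrow> real_polynomial_function (p i)"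
    "\<And>i. i \<in> I \<Longrightarrow> f i = (\<lambda>x. max 0 (1 - (norm x)\<^sup>2) ^ m * p i x)"
    using assms unfolding cutoff_poly_def mem_Collect_eq by metis
  show ?thesis
  proof (cases "finite I")
    case True
    have "(\<lambda>x. \<Sum>i\<in>I. f i x) = (\<lambda>x. max 0 (1 - (norm x)\<^sup>2) ^ m * (\<Sum>i\<in>I. p i x))"
      using p(2) by (simp add: sum_distrib_left)
    moreover have "real_polynomial_function (\<lambda>x. \<Sum>i\<in>I. p i x)"
      using True p(1) by (intro real_polynomial_function_sum) auto
    ultimately show ?thesis unfolding cutoff_poly_def by blast
  next
    case False
    then show ?thesis unfolding cutoff_poly_def
      by (auto intro!: exI[of _ "\<lambda>_. 0"] real_polynomial_function.intros)
  qed
qed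

lemma real_polynomial_function_norm_power2:
  "real_polynomial_function (\<lambda>x::'a::euclidean_space. (norm x)\<^sup>2)"
proof -
  have "(\<lambda>x::'a. (norm x)\<^sup>2) = (\<lambda>x. \<Sum>b\<in>Basis. (x \<bullet> b) * (x \<bullet> b))"
    unfolding power2_norm_eq_inner by (simp add: euclidean_inner[symmetric])
  moreover have "real_polynomial_function (\<lambda>x::'a. \<Sum>b\<in>Basis. (x \<bullet> b) * (x \<bullet> b))"
    by (intro real_polynomial_function_sum real_polynomial_function.intros bounded_linear_inner_left) auto
  ultimately show ?thesis by simp
qed

lemma cutoff_poly_partial:
  assumes "f \<in> cutoff_poly (Suc m)" "m \<ge> 1"
  shows "\<exists>f'\<in>cutoff_poly m. has_partial f b f'"
proof -
  obtain p where p: "real_polynomial_function p" "f = (\<lambda>x. max 0 (1 - (norm x)\<^sup>2) ^ Suc m * p x)"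
    using assms unfolding cutoff_poly_def by blast
  obtain p' where p': "real_polynomial_function p'"
    "\<And>x. ((\<lambda>t. p (x + t *\<^sub>R b)) has_real_derivative p' x) (at 0)"
    using real_polynomial_function_partial[OF p(1)] by blast
  define r where "r x = (1 + - 1 * (norm x)\<^sup>2) * p' x + (- 2 * real (Suc m)) * (x \<bullet> b) * p x" for x
  have r: "real_polynomial_function r"
    unfolding r_def by (intro real_polynomial_function.intros real_polynomial_function_norm_power2
        bounded_linear_inner_left p(1) p'(1))
  define f' where "f' x = max 0 (1 - (norm x)\<^sup>2) ^ m * r x" for x
  have f': "f' \<in> cutoff_poly m" unfolding cutoff_poly_def f'_def[abs_def] using r by blast
  moreover have "((\<lambda>t. f (x + t *\<^sub>R b)) has_real_derivative f' x) (at 0)" for x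
  proof -
    define Q where "Q t = 1 - (norm (x + t *\<^sub>R b))\<^sup>2" for t
    have "Q = (\<lambda>t. 1 - ((norm x)\<^sup>2 + 2 * t * (x \<bullet> b) + t\<^sup>2 * (norm b)\<^sup>2))"
      unfolding Q_def power2_norm_eq_inner
      by (simp add: fun_eq_iff inner_simps inner_commute algebra_simps power2_eq_square)
    then have dQ: "(Q has_real_derivative - 2 * (x \<bullet> b)) (at 0)"
      by (auto intro!: derivative_eq_intros)
    have "((\<lambda>t. max 0 (Q t) ^ Suc m) has_real_derivative
        (real (Suc m) * max 0 (Q 0) ^ m) * (- 2 * (x \<bullet> b))) (at 0)"
      by (rule DERIV_chain2[OF max_power_has_derivative[OF assms(2)] dQ])
    from DERIV_mult[OF this p'(2)[of x]]
    have "((\<lambda>t. f (x + t *\<^sub>R b)) has_real_derivative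
      (real (Suc m) * max 0 (Q 0) ^ m) * (- 2 * (x \<bullet> b)) * p x + p' x * max 0 (Q 0) ^ Suc m) (at 0)"
      unfolding p(2) Q_def by simp
    also have "max 0 (Q 0) ^ Suc m = Q 0 * max 0 (Q 0) ^ m"
      using assms(2) by (auto simp: max_def)
    also have "(real (Suc m) * max 0 (Q 0) ^ m) * (- 2 * (x \<bullet> b)) * p x + p' x * (Q 0 * max 0 (Q 0) ^ m) = f' x"
      unfolding f'_def r_def Q_def by (simp add: algebra_simps)
    finally show ?thesis .
  qed
  ultimately show ?thesis
    using continuous_cutoff_poly unfolding has_partial_def by blast
qed

lemma cutoff_poly_laplacian:
  assumes "f \<in> cutoff_poly (Suc (Suc m))" "m \<ge> 1"
  shows "\<exists>g\<in>cutoff_poly m. has_laplacian f g"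
proof -
  have "\<forall>b. \<exists>f1. f1 \<in> cutoff_poly (Suc m) \<and> has_partial f b f1"
    using cutoff_poly_partial[OF assms(1)] by auto
  then obtain f1 where f1: "\<And>b. f1 b \<in> cutoff_poly (Suc m)" "\<And>b. has_partial f b (f1 b)"
    by metis
  have "\<forall>b. \<exists>f2. f2 \<in> cutoff_poly m \<and> has_partial (f1 b) b f2"
    using cutoff_poly_partial[OF f1(1) assms(2)] by auto
  then obtain f2 where f2: "\<And>b. f2 b \<in> cutoff_poly m" "\<And>b. has_partial (f1 b) b (f2 b)"
    by metis
  have "has_laplacian f (\<lambda>x. \<Sum>b\<in>Basis. f2 b x)"
    unfolding has_laplacian_def using f1(2) f2(2) by (intro exI[of _ f1] exI[of _ f2]) simp
  then show ?thesis using cutoff_poly_sum[of Basis f2 m] f2(1) by blast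
qed

text \<open>
  Each Laplacian costs two in the exponent, and the last one must leave a continuous function, whence
  \<open>2 k + 1\<close>.
\<close>
lemma cutoff_poly_iterated_laplacian:
  assumes "f \<in> cutoff_poly (2 * k + 1)"
  shows "\<exists>F. F 0 = f \<and> (\<forall>j<k. has_laplacian (F j) (F (Suc j)))"
  using assms
proof (induction k arbitrary: f)
  case 0
  then show ?case by auto
next
  case (Suc k)
  obtain g where g: "g \<in> cutoff_poly (2 * k + 1)" "has_laplacian f g"
    using cutoff_poly_laplacian[of f "2 * k + 1"] Suc.prems by auto
  obtain G where G: "G 0 = g" "\<forall>j<k. has_laplacian (G j) (G (Suc j))"
    using Suc.IH[OF g(1)] by blast
  have "has_laplacian (case_nat f G j) (case_nat f G (Suc j))" if "j < Suc k" for j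
    using that g G by (cases j) auto
  then show ?case by (intro exI[of _ "case_nat f G"]) auto
qed

definition spline_kernel :: "real \<Rightarrow> real \<Rightarrow> real \<Rightarrow> 'a::real_normed_vector \<Rightarrow> 'a \<Rightarrow> real" where
  "spline_kernel \<alpha> \<beta> s x y = profile \<alpha> \<beta> s 1 0 ((norm (x - y))\<^sup>2)"

lemma continuous_spline_kernel:
  assumes "s > 0"
  shows "continuous_on A (\<lambda>(x, y). spline_kernel \<alpha> \<beta> s x y)"
  unfolding spline_kernel_def case_prod_unfold
  by (intro continuous_on_compose2[OF profile_continuous_at_0[OF assms]] continuous_intros) auto

lemma kernel_approx_cutoff_poly:
  fixes f :: "'a::euclidean_space \<Rightarrow> real"
  assumes f: "f \<in> cutoff_poly (2 * k + 1)"
    and par: "spline_parameters \<alpha> \<beta> s" and s: "s + real DIM('a) / 2 = real k"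
  shows "kernel_approx (spline_kernel \<alpha> \<beta> s) (cball 0 1) (cball 0 1) f"
proof -
  have s0: "s > 0" using par by (simp add: spline_parameters_def)
  obtain F where F: "F 0 = f" "\<And>j. j < k \<Longrightarrow> has_laplacian (F j) (F (Suc j))"
    using cutoff_poly_iterated_laplacian[OF f] by blast
  have cf: "continuous_on UNIV (F 0)" using F(1) continuous_cutoff_poly[OF f] by simp
  have supp: "F 0 x = 0" if "norm x > 1" for x
  proof -
    have "(norm x)\<^sup>2 > 1" using that by (simp add: one_less_power)
    then show ?thesis using f unfolding F(1) cutoff_poly_def by (auto simp: max_def)
  qed
  have F': "continuous_on UNIV (F j)" "\<And>x. norm x > 1 \<Longrightarrow> F j x = 0" if "j \<le> k" for j
    using iterated_laplacian_continuous_support[of F 1 k, OF cf supp F(2) that] by blast+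
  obtain C where C: "C \<noteq> 0"
    "\<And>x. (LINT y|lborel. F k y * profile \<alpha> \<beta> s 1 0 ((norm (y - x))\<^sup>2)) = C * F 0 x"
    using polyharmonic_representation[of F 1 k, OF cf supp F(2) zero_le_one par s] by blast
  have "kernel_approx (spline_kernel \<alpha> \<beta> s) (cball 0 1) (cball 0 1)
      (\<lambda>x. LINT y:cball 0 1|lborel. F k y * spline_kernel \<alpha> \<beta> s x y)"
    using F'[of k] by (intro kernel_approx_integral continuous_spline_kernel s0) (auto intro: continuous_on_subset)
  then have "kernel_approx (spline_kernel \<alpha> \<beta> s) (cball 0 1) (cball 0 1)
      (\<lambda>x. 1 / C * (LINT y:cball 0 1|lborel. F k y * spline_kernel \<alpha> \<beta> s x y))"
    by (rule kernel_approx_cmult)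
  moreover have "1 / C * (LINT y:cball 0 1|lborel. F k y * spline_kernel \<alpha> \<beta> s x y) = f x" for x
  proof -
    have "(LINT y:cball 0 1|lborel. F k y * spline_kernel \<alpha> \<beta> s x y)
        = (LINT y|lborel. F k y * profile \<alpha> \<beta> s 1 0 ((norm (y - x))\<^sup>2))"
      unfolding set_lebesgue_integral_def spline_kernel_def
      using F'[of k] by (intro Bochner_Integration.integral_cong) (auto simp: indicator_def norm_minus_commute)
    then show ?thesis using C F(1) by simp
  qed
  ultimately show ?thesis by simp
qed

text \<open>
  Divide \<open>f\<close> by \<open>(1 - |x|\<^sup>2)\<^sup>m\<close>, which is harmless where \<open>f\<close> does not vanish, approximate the quotient by a
  polynomial and multiply back; the factor is at most \<open>1\<close>, so the error does not grow.
\<close>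
lemma kernel_approx_vanishing_near_sphere:
  fixes f :: "'a::euclidean_space \<Rightarrow> real"
  assumes f: "continuous_on (cball 0 1) f" "\<And>x. norm x \<le> 1 \<Longrightarrow> norm x > \<rho> \<Longrightarrow> f x = 0"
    and \<rho>: "0 \<le> \<rho>" "\<rho> < 1"
    and par: "spline_parameters \<alpha> \<beta> s" and s: "s + real DIM('a) / 2 = real k"
  shows "kernel_approx (spline_kernel \<alpha> \<beta> s) (cball 0 1) (cball 0 1) f"
proof (rule kernel_approx_limit)
  fix e :: real assume e: "e > 0"
  have \<rho>2: "\<rho>\<^sup>2 < 1" using \<rho> by (simp add: power_less_one_iff abs_square_less_1)
  define m where "m = 2 * k + 1"
  \<comment> \<open>The maximum keeps the denominator positive up to the sphere; it changes nothing for \<open>norm x \<le> \<rho>\<close>.\<close>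
  define g where "g x = f x / max (1 - \<rho>\<^sup>2) (1 - (norm x)\<^sup>2) ^ m" for x
  have "continuous_on (cball 0 1) g"
    unfolding g_def using \<rho>2 by (intro continuous_intros f) (auto simp: max_def)
  then obtain p where p: "real_polynomial_function p" "\<And>x. x \<in> cball 0 1 \<Longrightarrow> \<bar>g x - p x\<bar> < e"
    using Stone_Weierstrass_real_polynomial_function[of "cball 0 1" g e] e by auto
  let ?h = "\<lambda>x::'a. max 0 (1 - (norm x)\<^sup>2) ^ m * p x"
  have "?h \<in> cutoff_poly m" unfolding cutoff_poly_def using p(1) by blast
  then have "kernel_approx (spline_kernel \<alpha> \<beta> s) (cball 0 1) (cball 0 1) ?h"
    using par s by (intro kernel_approx_cutoff_poly) (auto simp: m_def)
  moreover have "\<bar>f x - ?h x\<bar> \<le> e" if x: "x \<in> cball 0 1" for x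
  proof -
    have n: "(norm x)\<^sup>2 \<le> 1" using x by (simp add: power_le_one)
    have "f x = max 0 (1 - (norm x)\<^sup>2) ^ m * g x"
    proof (cases "norm x > \<rho>")
      case True
      then show ?thesis using f(2)[of x] x by (simp add: g_def)
    next
      case False
      then have "(norm x)\<^sup>2 \<le> \<rho>\<^sup>2" using \<rho> by (intro power_mono) auto
      then show ?thesis using \<rho>2 by (simp add: g_def max_def)
    qed
    then have "\<bar>f x - ?h x\<bar> = max 0 (1 - (norm x)\<^sup>2) ^ m * \<bar>g x - p x\<bar>"
      by (simp add: right_diff_distrib[symmetric] abs_mult power_abs)
    also have "\<dots> \<le> 1 * e"
      using p(2)[OF x] n by (intro mult_mono power_le_one) auto
    finally show ?thesis by simp
  qed
  ultimately show "\<exists>h. kernel_approx (spline_kernel \<alpha> \<beta> s) (cball 0 1) (cball 0 1) h \<and>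
      (\<forall>x\<in>cball 0 1. \<bar>f x - h x\<bar> \<le> e)" by blast
qed

section \<open>Functions on the sphere\<close>

lemma norm_sphere_minus_scaleR:
  fixes x v :: "'a::real_inner"
  assumes "norm x = 1" "norm v = 1"
  shows "(norm (x - t *\<^sub>R v))\<^sup>2 = 1 - 2 * t * (x \<bullet> v) + t\<^sup>2"
proof -
  have "x \<bullet> x = 1" "v \<bullet> v = 1" using assms by (simp_all add: power2_norm_eq_inner[symmetric])
  then show ?thesis
    unfolding power2_norm_eq_inner by (simp add: inner_simps inner_commute power2_eq_square)
qed

text \<open>
  With \<open>L = 2 t - 2 (x \<bullet> v)\<close> and \<open>q = 1 - 2 t (x \<bullet> v) + t\<^sup>2\<close>, the sum is the \<open>n\<close>-th \<open>t\<close>-derivative of \<open>\<psi>(q)\<close>: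
  differentiating \<open>L\<^sup>m \<psi>\<^sup>(\<^sup>l\<^sup>)(q)\<close> gives \<open>L\<^sup>m\<^sup>+\<^sup>1 \<psi>\<^sup>(\<^sup>l\<^sup>+\<^sup>1\<^sup>)(q) + 2 m L\<^sup>m\<^sup>-\<^sup>1 \<psi>\<^sup>(\<^sup>l\<^sup>)(q)\<close>. The coefficients \<open>a\<close> do not depend
  on \<open>v\<close>, and only \<open>a 0 = 1\<close>, their signs and the range of the sum matter later.
\<close>
lemma kernel_approx_zonal_derivatives:
  fixes \<alpha> \<beta> s :: real
  defines "P \<equiv> \<lambda>n. profile \<alpha> \<beta> s (falling_poly n) n"
  shows "\<exists>a::nat \<Rightarrow> real. a 0 = 1 \<and> (\<forall>j. a j \<ge> 0) \<and> (\<forall>j. 2 * j > n \<longrightarrow> a j = 0) \<and>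
    (\<forall>v::'a::euclidean_space. \<forall>t. norm v = 1 \<longrightarrow> t \<in> {-1<..<1} \<longrightarrow>
      kernel_approx (spline_kernel \<alpha> \<beta> s) (cball 0 1) (sphere 0 1)
        (\<lambda>x. \<Sum>j\<le>n. a j * (2 * t - 2 * (x \<bullet> v)) ^ (n - 2 * j) * P (n - j) (1 - 2 * t * (x \<bullet> v) + t\<^sup>2)))"
proof (induction n)
  case 0
  have "kernel_approx (spline_kernel \<alpha> \<beta> s) (cball 0 1) (sphere 0 1)
        (\<lambda>x. P 0 (1 - 2 * t * (x \<bullet> v) + t\<^sup>2))" if "norm v = 1" "t \<in> {-1<..<1}" for v :: 'a and t
  proof (rule kernel_approx_cong)
    show "kernel_approx (spline_kernel \<alpha> \<beta> s) (cball 0 1) (sphere 0 1) (\<lambda>x. spline_kernel \<alpha> \<beta> s x (t *\<^sub>R v))"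
      using that by (intro kernel_approx_kernel) auto
    show "spline_kernel \<alpha> \<beta> s x (t *\<^sub>R v) = P 0 (1 - 2 * t * (x \<bullet> v) + t\<^sup>2)" if "x \<in> sphere 0 1" for x
      using norm_sphere_minus_scaleR[of x v t] that \<open>norm v = 1\<close>
      by (simp add: spline_kernel_def P_def falling_poly_def)
  qed
  then show ?case by (intro exI[of _ "\<lambda>j. if j = 0 then 1 else 0"]) auto
next
  case (Suc n)
  then obtain a :: "nat \<Rightarrow> real" where a: "a 0 = 1" "\<And>j. a j \<ge> 0" "\<And>j. 2 * j > n \<Longrightarrow> a j = 0"
    and H: "\<And>v::'a. \<And>t. norm v = 1 \<Longrightarrow> t \<in> {-1<..<1} \<Longrightarrow>
      kernel_approx (spline_kernel \<alpha> \<beta> s) (cball 0 1) (sphere 0 1)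
        (\<lambda>x. \<Sum>j\<le>n. a j * (2 * t - 2 * (x \<bullet> v)) ^ (n - 2 * j) * P (n - j) (1 - 2 * t * (x \<bullet> v) + t\<^sup>2))"
    by blast
  \<comment> \<open>The second summand comes from differentiating the powers of \<open>L\<close>, which moves index \<open>i\<close> to \<open>i + 1\<close>.\<close>
  define b where "b j = a j + (case j of 0 \<Rightarrow> 0 | Suc i \<Rightarrow> 2 * real (n - 2 * i) * a i)" for j
  have b: "b 0 = 1" "\<And>j. b j \<ge> 0" "\<And>j. 2 * j > Suc n \<Longrightarrow> b j = 0"
    using a by (auto simp: b_def split: nat.split)
  have dP: "(P l has_real_derivative P (Suc l) q) (at q)" if "q > 0" for l q
    unfolding P_def falling_poly_Suc using that by (rule profile_has_derivative)
  have cP: "continuous_on {0<..} (P l)" for l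
    unfolding P_def by (rule profile_continuous)
  have "kernel_approx (spline_kernel \<alpha> \<beta> s) (cball 0 1) (sphere 0 1)
        (\<lambda>x. \<Sum>j\<le>Suc n. b j * (2 * t - 2 * (x \<bullet> v)) ^ (Suc n - 2 * j) * P (Suc n - j) (1 - 2 * t * (x \<bullet> v) + t\<^sup>2))"
    if v: "norm v = 1" and t: "t \<in> {-1<..<1}" for v :: 'a and t
  proof (rule kernel_approx_derivative[where r = 1 and H = "\<lambda>t x. \<Sum>j\<le>n. a j * (2 * t - 2 * (x \<bullet> v)) ^ (n - 2 * j) * P (n - j) (1 - 2 * t * (x \<bullet> v) + t\<^sup>2)"
        and H' = "\<lambda>t x. \<Sum>j\<le>Suc n. b j * (2 * t - 2 * (x \<bullet> v)) ^ (Suc n - 2 * j) * P (Suc n - j) (1 - 2 * t * (x \<bullet> v) + t\<^sup>2)"])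
    have Qpos: "1 - 2 * t * (x \<bullet> v) + t\<^sup>2 > 0" if "t \<in> {-1<..<1}" "x \<in> sphere 0 1" for t and x :: 'a
    proof -
      have "x \<noteq> t *\<^sub>R v" using that v by auto
      then have pos: "(norm (x - t *\<^sub>R v))\<^sup>2 > 0" by simp
      have "(norm (x - t *\<^sub>R v))\<^sup>2 = 1 - 2 * t * (x \<bullet> v) + t\<^sup>2"
        using that v by (intro norm_sphere_minus_scaleR) auto
      then show ?thesis using pos by (simp only:)
    qed
    show "compact (sphere 0 1 :: 'a set)" by simp
    show "kernel_approx (spline_kernel \<alpha> \<beta> s) (cball 0 1) (sphere 0 1)
        (\<lambda>x. \<Sum>j\<le>n. a j * (2 * t - 2 * (x \<bullet> v)) ^ (n - 2 * j) * P (n - j) (1 - 2 * t * (x \<bullet> v) + t\<^sup>2))"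
      if "t \<in> {-1<..<1}" for t using v that by (rule H)
    show "t \<in> {-1<..<1}" by (rule t)
    show "continuous_on ({-1<..<1} \<times> sphere 0 1)
        (\<lambda>(t, x). \<Sum>j\<le>Suc n. b j * (2 * t - 2 * (x \<bullet> v)) ^ (Suc n - 2 * j) * P (Suc n - j) (1 - 2 * t * (x \<bullet> v) + t\<^sup>2))"
      unfolding case_prod_unfold using Qpos
      by (intro continuous_intros continuous_on_compose2[OF cP]) auto
    fix t :: real and x :: 'a assume tx: "t \<in> {-1<..<1}" "x \<in> sphere 0 1"
    define L where "L = 2 * t - 2 * (x \<bullet> v)"
    define q where "q = 1 - 2 * t * (x \<bullet> v) + t\<^sup>2"
    have dL: "((\<lambda>t. (2 * t - 2 * (x \<bullet> v)) ^ m) has_real_derivative 2 * real m * L ^ (m - 1)) (at t)" for m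
      unfolding L_def by (auto intro!: derivative_eq_intros)
    have "((\<lambda>t. 1 - 2 * t * (x \<bullet> v) + t\<^sup>2) has_real_derivative L) (at t)"
      unfolding L_def by (auto intro!: derivative_eq_intros)
    then have dq: "((\<lambda>t. P l (1 - 2 * t * (x \<bullet> v) + t\<^sup>2)) has_real_derivative P (Suc l) q * L) (at t)" for l
      using DERIV_chain2[where g = "\<lambda>t. 1 - 2 * t * (x \<bullet> v) + t\<^sup>2" and x = t, OF dP] Qpos[OF tx]
      unfolding q_def by blast
    have summand: "((\<lambda>t. a j * (2 * t - 2 * (x \<bullet> v)) ^ m * P l (1 - 2 * t * (x \<bullet> v) + t\<^sup>2))
        has_real_derivative a j * (2 * real m * L ^ (m - 1) * P l q + P (Suc l) q * L * L ^ m)) (at t)" for j m l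
      using DERIV_cmult[OF DERIV_mult[OF dL[of m] dq[of l]], of "a j"]
      by (simp only: L_def q_def mult.assoc)
    have "((\<lambda>t. \<Sum>j\<le>n. a j * (2 * t - 2 * (x \<bullet> v)) ^ (n - 2 * j) * P (n - j) (1 - 2 * t * (x \<bullet> v) + t\<^sup>2))
      has_real_derivative (\<Sum>j\<le>n. a j * (2 * real (n - 2 * j) * L ^ (n - 2 * j - 1) * P (n - j) q
         + P (Suc (n - j)) q * L * L ^ (n - 2 * j)))) (at t)"
      by (intro DERIV_sum summand)
    also have "(\<Sum>j\<le>n. a j * (2 * real (n - 2 * j) * L ^ (n - 2 * j - 1) * P (n - j) q
         + P (Suc (n - j)) q * L * L ^ (n - 2 * j)))
       = (\<Sum>j\<le>n. a j * L ^ (Suc n - 2 * j) * P (Suc n - j) q)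
       + (\<Sum>j\<le>n. 2 * real (n - 2 * j) * a j * L ^ (n - 2 * j - 1) * P (n - j) q)"
    proof -
      have raise: "a j * (P (Suc (n - j)) q * L * L ^ (n - 2 * j)) = a j * L ^ (Suc n - 2 * j) * P (Suc n - j) q" if "j \<le> n" for j
      proof (cases "2 * j > n")
        \<comment> \<open>The truncated exponents on the two sides do not match here, but the coefficient is zero.\<close>
        case True
        then show ?thesis using a(3) by simp
      next
        case False
        then have "Suc n - 2 * j = Suc (n - 2 * j)" "Suc n - j = Suc (n - j)" by auto
        then show ?thesis by simp
      qed
      show ?thesis
        unfolding sum.distrib[symmetric]
      proof (rule sum.cong)
        fix j assume "j \<in> {..n}"
        then have "j \<le> n" by simp
        show "a j * (2 * real (n - 2 * j) * L ^ (n - 2 * j - 1) * P (n - j) q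
            + P (Suc (n - j)) q * L * L ^ (n - 2 * j))
          = a j * L ^ (Suc n - 2 * j) * P (Suc n - j) q
            + 2 * real (n - 2 * j) * a j * L ^ (n - 2 * j - 1) * P (n - j) q"
          unfolding distrib_left raise[OF \<open>j \<le> n\<close>] by (simp only: mult_ac add_ac)
      qed simp
    qed
    also have "(\<Sum>j\<le>n. a j * L ^ (Suc n - 2 * j) * P (Suc n - j) q)
       + (\<Sum>j\<le>n. 2 * real (n - 2 * j) * a j * L ^ (n - 2 * j - 1) * P (n - j) q)
       = (\<Sum>j\<le>Suc n. b j * L ^ (Suc n - 2 * j) * P (Suc n - j) q)"
    proof -
      have "(\<Sum>j\<le>Suc n. b j * L ^ (Suc n - 2 * j) * P (Suc n - j) q)
        = (\<Sum>j\<le>Suc n. a j * L ^ (Suc n - 2 * j) * P (Suc n - j) q)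
        + (\<Sum>j\<le>Suc n. (case j of 0 \<Rightarrow> 0 | Suc i \<Rightarrow> 2 * real (n - 2 * i) * a i) * L ^ (Suc n - 2 * j) * P (Suc n - j) q)"
        unfolding b_def by (simp only: distrib_right sum.distrib)
      also have "(\<Sum>j\<le>Suc n. a j * L ^ (Suc n - 2 * j) * P (Suc n - j) q)
          = (\<Sum>j\<le>n. a j * L ^ (Suc n - 2 * j) * P (Suc n - j) q)"
        using a(3)[of "Suc n"] by simp
      also have "(\<Sum>j\<le>Suc n. (case j of 0 \<Rightarrow> 0 | Suc i \<Rightarrow> 2 * real (n - 2 * i) * a i) * L ^ (Suc n - 2 * j) * P (Suc n - j) q)
         = (\<Sum>j\<le>n. 2 * real (n - 2 * j) * a j * L ^ (n - 2 * j - 1) * P (n - j) q)"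
      proof -
        have index: "Suc n - 2 * Suc j = n - 2 * j - 1" "Suc n - Suc j = n - j" for j by auto
        show ?thesis
          by (subst sum.atMost_Suc_shift) (simp only: index nat.case mult_zero_left add_0)
      qed
      finally show ?thesis by simp
    qed
    finally show "((\<lambda>t. \<Sum>j\<le>n. a j * (2 * t - 2 * (x \<bullet> v)) ^ (n - 2 * j) * P (n - j) (1 - 2 * t * (x \<bullet> v) + t\<^sup>2))
      has_real_derivative (\<Sum>j\<le>Suc n. b j * (2 * t - 2 * (x \<bullet> v)) ^ (Suc n - 2 * j) * P (Suc n - j) (1 - 2 * t * (x \<bullet> v) + t\<^sup>2))) (at t)"
      unfolding L_def q_def .
  qed
  then show ?case using b by (intro exI[of _ b]) blast
qed

text \<open>
  For \<open>\<psi>(q) = q\<^sup>s\<close> the kernel centred at \<open>0\<close> is constant on the sphere. In the logarithmic case that kernel vanishes on the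
  sphere. There the second \<open>t\<close>-derivative at \<open>t = 0\<close> is \<open>4 \<psi>''(1) (x \<bullet> v)\<^sup>2 + a\<^sub>1 \<psi>'(1)\<close>. Its sum over the
  standard basis vectors \<open>v\<close> is constant on the sphere, and positive since \<open>s \<ge> 1\<close>.
\<close>
lemma kernel_approx_sphere_const:
  assumes par: "spline_parameters \<alpha> \<beta> s"
  shows "kernel_approx (spline_kernel \<alpha> \<beta> s) (cball 0 1) (sphere 0 1) (\<lambda>x::'a::euclidean_space. c)"
proof -
  let ?W = "kernel_approx (spline_kernel \<alpha> \<beta> s) (cball 0 1) (sphere 0 1) :: ('a \<Rightarrow> real) \<Rightarrow> bool"
  have "\<exists>d. d \<noteq> 0 \<and> ?W (\<lambda>x. d)"
  proof (cases "\<beta> = 0")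
    case True
    then have "\<alpha> = 1" using par by (auto simp: spline_parameters_def)
    have "?W (\<lambda>x. spline_kernel \<alpha> \<beta> s x 0)" by (rule kernel_approx_kernel) simp
    then have "?W (\<lambda>x. 1)"
      by (rule kernel_approx_cong) (simp add: spline_kernel_def profile_def True \<open>\<alpha> = 1\<close>)
    then show ?thesis by (intro exI[of _ 1]) simp
  next
    case False
    then have ab: "\<alpha> = 0" "\<beta> = 1 / 2" "s \<ge> 1" using par by (auto simp: spline_parameters_def)
    let ?P = "\<lambda>n. profile \<alpha> \<beta> s (falling_poly n) n 1"
    have P1: "?P 1 > 0" and P2: "?P 2 > 0"
      using ab by (auto simp: profile_def falling_poly_def numeral_2_eq_2 pderiv_pCons pderiv_mult)
    obtain a :: "nat \<Rightarrow> real" where a: "a 0 = 1" "\<And>j. a j \<ge> 0" "\<And>j. 2 * j > 2 \<Longrightarrow> a j = 0"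
      and H: "\<And>v::'a. \<And>t. norm v = 1 \<Longrightarrow> t \<in> {-1<..<1} \<Longrightarrow>
       ?W (\<lambda>x. \<Sum>j\<le>2. a j * (2 * t - 2 * (x \<bullet> v)) ^ (2 - 2 * j) *
            profile \<alpha> \<beta> s (falling_poly (2 - j)) (2 - j) (1 - 2 * t * (x \<bullet> v) + t\<^sup>2))"
      using kernel_approx_zonal_derivatives[where 'a = 'a, of 2 \<alpha> \<beta> s] by blast
    have W: "?W (\<lambda>x. 4 * ?P 2 * (x \<bullet> v)\<^sup>2 + a 1 * ?P 1)" if "v \<in> Basis" for v
      using H[of v 0] that a(1) a(3)[of 2] by (simp add: numeral_2_eq_2 mult_ac)
    have "?W (\<lambda>x. \<Sum>v\<in>Basis. 4 * ?P 2 * (x \<bullet> v)\<^sup>2 + a 1 * ?P 1)"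
      by (intro kernel_approx_sum W)
    then have "?W (\<lambda>x. 4 * ?P 2 + real DIM('a) * (a 1 * ?P 1))"
    proof (rule kernel_approx_cong)
      fix x :: 'a assume "x \<in> sphere 0 1"
      then have "1 = (\<Sum>b\<in>Basis. (x \<bullet> b)\<^sup>2)"
        using euclidean_inner[of x x] by (simp add: power2_eq_square power2_norm_eq_inner[symmetric] norm_eq_1)
      then show "(\<Sum>v\<in>Basis. 4 * ?P 2 * (x \<bullet> v)\<^sup>2 + a 1 * ?P 1) = 4 * ?P 2 + real DIM('a) * (a 1 * ?P 1)"
        by (simp add: sum.distrib sum_distrib_left[symmetric])
    qed
    moreover have "4 * ?P 2 + real DIM('a) * (a 1 * ?P 1) > 0"
      using P1 P2 a(2)[of 1] by (intro add_pos_nonneg) auto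
    ultimately show ?thesis by (metis less_irrefl)
  qed
  then obtain d where "d \<noteq> 0" "?W (\<lambda>x. d)" by blast
  then show ?thesis using kernel_approx_cmult[of _ _ _ "\<lambda>x. d" "c / d"] by simp
qed

text \<open>
  Strong induction on \<open>n\<close> for unit vectors \<open>v\<close>: at \<open>t = 0\<close> the \<open>n\<close>-th derivative is \<open>(-2)\<^sup>n \<psi>\<^sup>(\<^sup>n\<^sup>)(1) (x \<bullet> v)\<^sup>n\<close>
  plus lower powers of \<open>x \<bullet> v\<close>, and the leading coefficient is nonzero for \<open>n \<ge> 1\<close>.
\<close>
lemma kernel_approx_sphere_ridge_power:
  fixes v :: "'a::euclidean_space"
  assumes par: "spline_parameters \<alpha> \<beta> s"
  shows "kernel_approx (spline_kernel \<alpha> \<beta> s) (cball 0 1) (sphere 0 1) (\<lambda>x. (x \<bullet> v) ^ n)"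
proof -
  let ?W = "kernel_approx (spline_kernel \<alpha> \<beta> s) (cball 0 1) (sphere 0 1) :: ('a \<Rightarrow> real) \<Rightarrow> bool"
  have unit: "?W (\<lambda>x. (x \<bullet> v) ^ n)" if v: "norm v = 1" for v n
  proof (induction n rule: less_induct)
    case (less n)
    show ?case
    proof (cases "n = 0")
      case True
      then show ?thesis using kernel_approx_sphere_const[OF par] by simp
    next
      case False
      let ?P = "\<lambda>n. profile \<alpha> \<beta> s (falling_poly n) n 1"
      obtain a :: "nat \<Rightarrow> real" where a: "a 0 = 1"
        and H: "\<And>v::'a. \<And>t. norm v = 1 \<Longrightarrow> t \<in> {-1<..<1} \<Longrightarrow>
         ?W (\<lambda>x. \<Sum>j\<le>n. a j * (2 * t - 2 * (x \<bullet> v)) ^ (n - 2 * j) *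
              profile \<alpha> \<beta> s (falling_poly (n - j)) (n - j) (1 - 2 * t * (x \<bullet> v) + t\<^sup>2))"
        using kernel_approx_zonal_derivatives[where 'a = 'a, of n \<alpha> \<beta> s] by blast
      define c where "c j = a j * (-2) ^ (n - 2 * j) * ?P (n - j)" for j
      have "(2 * 0 - 2 * z) ^ m = (-2) ^ m * z ^ m" for z :: real and m
        by (simp add: power_mult_distrib[symmetric])
      then have "?W (\<lambda>x. \<Sum>j\<le>n. c j * (x \<bullet> v) ^ (n - 2 * j))"
        using H[of v 0] v by (simp add: c_def mult_ac)
      moreover have "?W (\<lambda>x. \<Sum>j\<in>{1..n}. c j * (x \<bullet> v) ^ (n - 2 * j))"
        using False by (intro kernel_approx_sum kernel_approx_cmult less.IH) auto
      ultimately have "?W (\<lambda>x. (\<Sum>j\<le>n. c j * (x \<bullet> v) ^ (n - 2 * j)) - (\<Sum>j\<in>{1..n}. c j * (x \<bullet> v) ^ (n - 2 * j)))"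
        by (rule kernel_approx_diff)
      moreover have "(\<Sum>j\<le>n. c j * z ^ (n - 2 * j)) - (\<Sum>j\<in>{1..n}. c j * z ^ (n - 2 * j)) = c 0 * z ^ n" for z :: real
      proof -
        have "{..n} = insert 0 {1..n}" by auto
        then show ?thesis by simp
      qed
      ultimately have "?W (\<lambda>x. c 0 * (x \<bullet> v) ^ n)" by simp
      then have "?W (\<lambda>x. inverse (c 0) * (c 0 * (x \<bullet> v) ^ n))" by (rule kernel_approx_cmult)
      moreover have "c 0 \<noteq> 0"
        using profile_falling_poly_nonzero[OF par, of n] False a by (simp add: c_def)
      ultimately show ?thesis by (simp add: mult.assoc[symmetric])
    qed
  qed
  show ?thesis
  proof (cases "v = 0")
    case True
    then show ?thesis using kernel_approx_sphere_const[OF par, of "0 ^ n"] by simp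
  next
    case False
    then have "?W (\<lambda>x. norm v ^ n * (x \<bullet> (v /\<^sub>R norm v)) ^ n)"
      by (intro kernel_approx_cmult unit) simp
    moreover have "norm v ^ n * (x \<bullet> (v /\<^sub>R norm v)) ^ n = (x \<bullet> v) ^ n" for x
    proof -
      have "norm v * (x \<bullet> (v /\<^sub>R norm v)) = x \<bullet> v" using False by simp
      then show ?thesis by (metis power_mult_distrib)
    qed
    ultimately show ?thesis by simp
  qed
qed

lemma kernel_approx_sphere_exp:
  fixes v :: "'a::euclidean_space"
  assumes par: "spline_parameters \<alpha> \<beta> s"
  shows "kernel_approx (spline_kernel \<alpha> \<beta> s) (cball 0 1) (sphere 0 1) (\<lambda>x. exp (x \<bullet> v))"
proof (rule kernel_approx_limit)
  fix e :: real assume e: "e > 0"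
  have "uniform_limit (sphere 0 1) (\<lambda>N x. \<Sum>n<N. (x \<bullet> v) ^ n /\<^sub>R fact n) (\<lambda>x. \<Sum>n. (x \<bullet> v) ^ n /\<^sub>R fact n) sequentially"
  proof (rule Weierstrass_m_test)
    show "norm ((x \<bullet> v) ^ n /\<^sub>R fact n) \<le> norm v ^ n /\<^sub>R fact n" if "x \<in> sphere 0 1" for n x
    proof -
      have "\<bar>x \<bullet> v\<bar> \<le> norm v" using Cauchy_Schwarz_ineq2[of x v] that by simp
      then show ?thesis by (auto simp: power_abs abs_mult intro!: mult_left_mono power_mono)
    qed
    show "summable (\<lambda>n. norm v ^ n /\<^sub>R fact n)" by (rule summable_exp_generic)
  qed
  then have "\<forall>\<^sub>F N in sequentially. \<forall>x\<in>sphere 0 1. dist (\<Sum>n<N. (x \<bullet> v) ^ n /\<^sub>R fact n) (exp (x \<bullet> v)) < e"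
    using e unfolding uniform_limit_iff exp_def by blast
  then obtain N where N: "\<And>x. x \<in> sphere 0 1 \<Longrightarrow> dist (\<Sum>n<N. (x \<bullet> v) ^ n /\<^sub>R fact n) (exp (x \<bullet> v)) < e"
    unfolding eventually_sequentially by blast
  have "kernel_approx (spline_kernel \<alpha> \<beta> s) (cball 0 1) (sphere 0 1) (\<lambda>x. \<Sum>n<N. inverse (fact n) * (x \<bullet> v) ^ n)"
    by (intro kernel_approx_sum kernel_approx_cmult kernel_approx_sphere_ridge_power par)
  moreover have "\<bar>exp (x \<bullet> v) - (\<Sum>n<N. inverse (fact n) * (x \<bullet> v) ^ n)\<bar> \<le> e" if "x \<in> sphere 0 1" for x
    using N[OF that] by (simp add: dist_real_def abs_minus_commute)
  ultimately show "\<exists>g. kernel_approx (spline_kernel \<alpha> \<beta> s) (cball 0 1) (sphere 0 1) g \<and>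
      (\<forall>x\<in>sphere 0 1. \<bar>exp (x \<bullet> v) - g x\<bar> \<le> e)" by blast
qed

text \<open>
  Exponentials are used instead of polynomials because the product of \<open>exp (x \<bullet> v)\<close> and \<open>exp (x \<bullet> w)\<close> is again a
  single exponential, which makes their span an algebra at once.
\<close>
inductive exponential_sum :: "('a::real_inner \<Rightarrow> real) \<Rightarrow> bool" where
  exponential: "exponential_sum (\<lambda>x. c * exp (x \<bullet> v))"
| plus: "exponential_sum f \<Longrightarrow> exponential_sum g \<Longrightarrow> exponential_sum (\<lambda>x. f x + g x)"

lemma exponential_sum_mult:
  assumes "exponential_sum f" "exponential_sum g"
  shows "exponential_sum (\<lambda>x. f x * g x)"
  using assms(1)
proof induction
  case (exponential c v)
  show ?case using assms(2)
  proof induction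
    case (exponential d w)
    show ?case
      using exponential_sum.exponential[of "c * d" "v + w"] by (simp add: inner_add_right exp_add mult_ac)
  next
    case (plus f g)
    from exponential_sum.plus[OF plus.IH] show ?case by (simp add: distrib_left)
  qed
next
  case (plus f h)
  from exponential_sum.plus[OF plus.IH] show ?case by (simp add: distrib_right)
qed

lemma kernel_approx_sphere:
  fixes f :: "'a::euclidean_space \<Rightarrow> real"
  assumes par: "spline_parameters \<alpha> \<beta> s" and f: "continuous_on (sphere 0 1) f"
  shows "kernel_approx (spline_kernel \<alpha> \<beta> s) (cball 0 1) (sphere 0 1) f"
proof (rule kernel_approx_limit)
  let ?W = "kernel_approx (spline_kernel \<alpha> \<beta> s) (cball 0 1) (sphere 0 1) :: ('a \<Rightarrow> real) \<Rightarrow> bool"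
  fix e :: real assume e: "e > 0"
  have "\<exists>g. exponential_sum g \<and> (\<forall>x\<in>sphere 0 1. \<bar>f x - g x\<bar> < e)"
  proof (rule Stone_Weierstrass_HOL)
    show "compact (sphere 0 1 :: 'a set)" by simp
    show "exponential_sum (\<lambda>x::'a. c)" for c
      using exponential[of c 0] by simp
    show "continuous_on (sphere 0 1) g" if "exponential_sum g" for g :: "'a \<Rightarrow> real"
      using that by induction (auto intro!: continuous_intros)
    show "\<exists>g. exponential_sum g \<and> g x \<noteq> g y" if "x \<in> sphere 0 1 \<and> y \<in> sphere 0 1 \<and> x \<noteq> y" for x y :: 'a
    proof -
      have "(x - y) \<bullet> (x - y) \<noteq> 0" using that by simp
      then have "x \<bullet> (x - y) \<noteq> y \<bullet> (x - y)" by (simp add: inner_diff_left)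
      then show ?thesis using exponential[of 1 "x - y"] by (intro exI[of _ "\<lambda>z. 1 * exp (z \<bullet> (x - y))"]) simp
    qed
  qed (use plus exponential_sum_mult f e in auto)
  then obtain g where g: "exponential_sum g" "\<And>x. x \<in> sphere 0 1 \<Longrightarrow> \<bar>f x - g x\<bar> < e" by blast
  have "?W g" using g(1)
    by induction (auto intro: kernel_approx_cmult kernel_approx_add kernel_approx_sphere_exp[OF par])
  then show "\<exists>g. ?W g \<and> (\<forall>x\<in>sphere 0 1. \<bar>f x - g x\<bar> \<le> e)" using g(2) by (meson less_imp_le)
qed

section \<open>Approximation on the ball\<close>

text \<open>
  The remainder after matching \<open>f\<close> on the sphere is small there. Shrinking its values towards \<open>0\<close> by
  \<open>e\<close> changes it by at most \<open>e\<close> and makes it vanish near the sphere by compactness.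
\<close>
lemma kernel_approx_cball:
  fixes f :: "'a::euclidean_space \<Rightarrow> real"
  assumes f: "continuous_on (cball 0 1) f"
    and par: "spline_parameters \<alpha> \<beta> s" and s: "s + real DIM('a) / 2 = real k"
  shows "kernel_approx (spline_kernel \<alpha> \<beta> s) (cball 0 1) (cball 0 1) f"
proof (rule kernel_approx_limit)
  let ?K = "spline_kernel \<alpha> \<beta> s :: 'a \<Rightarrow> 'a \<Rightarrow> real"
  fix e :: real assume "e > 0"
  define d where "d = e / 2"
  have d: "d > 0" using \<open>e > 0\<close> by (simp add: d_def)
  have s0: "s > 0" using par by (simp add: spline_parameters_def)
  have "kernel_approx ?K (cball 0 1) (sphere 0 1) f"
    by (intro kernel_approx_sphere par continuous_on_subset[OF f]) auto
  then obtain Y a where Y: "finite Y" "Y \<subseteq> cball 0 1"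
    "\<And>x. x \<in> sphere 0 1 \<Longrightarrow> \<bar>f x - (\<Sum>y\<in>Y. a y * ?K x y)\<bar> \<le> d"
    by (rule kernel_approxE[OF _ d]) blast
  define S where "S x = (\<Sum>y\<in>Y. a y * ?K x y)" for x
  have S: "kernel_approx ?K (cball 0 1) (cball 0 1) S"
    using Y by (intro kernel_approxI[of Y _ _ _ a]) (auto simp: S_def)
  have cS: "continuous_on (cball 0 1) S"
    unfolding S_def spline_kernel_def
    by (intro continuous_intros continuous_on_compose2[OF profile_continuous_at_0[OF s0]]) auto
  define g where "g x = f x - S x" for x
  have cg: "continuous_on (cball 0 1) g" unfolding g_def by (intro continuous_intros f cS)
  have gs: "\<bar>g x\<bar> \<le> d" if "norm x = 1" for x
    using Y(3)[of x] that by (simp add: g_def S_def)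
  define h where "h x = max 0 (g x - e) + min 0 (g x + e)" for x
  have ch: "continuous_on (cball 0 1) h" unfolding h_def by (intro continuous_intros cg)
  have gh: "\<bar>g x - h x\<bar> \<le> e" for x using \<open>e > 0\<close> by (auto simp: h_def max_def min_def)
  obtain \<rho> where \<rho>: "0 \<le> \<rho>" "\<rho> < 1" "\<And>x. norm x \<le> 1 \<Longrightarrow> norm x > \<rho> \<Longrightarrow> h x = 0"
  proof -
    \<comment> \<open>Outside of the compact set \<open>E\<close>, which does not meet the sphere, \<open>h\<close> vanishes.\<close>
    define E where "E = cball 0 1 \<inter> (\<lambda>x. \<bar>g x\<bar>) -` {e..}"
    have "closedin (top_of_set (cball 0 1)) E"
      unfolding E_def by (intro continuous_closedin_preimage continuous_intros cg)
    then have cE: "compact E" by (intro closedin_compact[of "cball 0 1" E]) auto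
    have out: "h x = 0" if "norm x \<le> 1" "x \<notin> E" for x
      using that \<open>e > 0\<close> by (auto simp: E_def h_def max_def min_def)
    show thesis
    proof (cases "E = {}")
      case True
      then show thesis using out by (intro that[of 0]) auto
    next
      case False
      then obtain z where z: "z \<in> E" "\<And>x. x \<in> E \<Longrightarrow> norm x \<le> norm z"
        using continuous_attains_sup[OF cE False, of norm] by (auto intro: continuous_intros)
      have "norm z \<noteq> 1" using gs[of z] z(1) \<open>e > 0\<close> by (auto simp: E_def d_def)
      then have "norm z < 1" using z(1) by (auto simp: E_def)
      then show thesis using out z(2) by (intro that[of "norm z"]) force+
    qed
  qed
  have "kernel_approx ?K (cball 0 1) (cball 0 1) h"
    using ch \<rho> par s by (intro kernel_approx_vanishing_near_sphere[of h \<rho>]) auto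
  then have "kernel_approx ?K (cball 0 1) (cball 0 1) (\<lambda>x. S x + h x)"
    by (rule kernel_approx_add[OF S])
  moreover have "\<bar>f x - (S x + h x)\<bar> \<le> e" for x
    using gh[of x] by (simp add: g_def diff_diff_eq)
  ultimately show "\<exists>g. kernel_approx ?K (cball 0 1) (cball 0 1) g \<and> (\<forall>x\<in>cball 0 1. \<bar>f x - g x\<bar> \<le> e)"
    by blast
qed

lemma polyharmonic_spline_eq_profile:
  assumes "d < 2 * k" "r \<ge> 0"
  shows "polyharmonic_spline d k r =
    profile (if odd d then 1 else 0) (if odd d then 0 else 1 / 2) (real k - real d / 2) 1 0 (r\<^sup>2)"
proof (cases "r = 0")
  case True
  then show ?thesis using assms by (simp add: polyharmonic_spline_def profile_def)
next
  case False
  then have r: "r > 0" using assms by simp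
  have "(r\<^sup>2) powr (real k - real d / 2) = (r powr 2) powr (real k - real d / 2)"
    using r by simp
  also have "\<dots> = r powr real (2 * k - d)"
    unfolding powr_powr by (rule arg_cong[of _ _ "\<lambda>p. r powr p"]) (use assms in \<open>simp add: of_nat_diff\<close>)
  also have "\<dots> = r ^ (2 * k - d)" using r by (rule powr_realpow)
  finally have "(r\<^sup>2) powr (real k - real d / 2) = r ^ (2 * k - d)" .
  moreover have "ln (r\<^sup>2) = 2 * ln r" using r by (simp add: ln_realpow)
  ultimately show ?thesis by (simp add: polyharmonic_spline_def profile_def pderiv_1)
qed

lemma spline_parameters_polyharmonic:
  assumes "d < 2 * k"
  shows "spline_parameters (if odd d then 1 else 0) (if odd d then 0 else 1 / 2) (real k - real d / 2)"
proof (cases "odd d")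
  case True
  have "real k - real d / 2 \<noteq> real n" for n :: nat
  proof
    assume "real k - real d / 2 = real n"
    then have "real (2 * k) = real (2 * n + d)" by simp
    then have "2 * k = 2 * n + d" by (simp only: of_nat_eq_iff)
    then show False using True by presburger
  qed
  then show ?thesis using assms True by (auto simp: spline_parameters_def)
next
  case False
  then obtain m where "d = 2 * m" by auto
  then have "real k - real d / 2 = real (k - m)" using assms by simp
  then have "\<exists>n::nat. real k - real d / 2 = real n" by (rule exI)
  then show ?thesis using False assms by (simp add: spline_parameters_def)
qed

theorem theorem11:
  fixes f :: "real ^ 'd \<Rightarrow> real" and k :: nat and \<epsilon> :: real
  assumes "real k > real CARD('d) / 2"
    and "continuous_on (cball 0 1) f"
    and "\<epsilon> > 0"
  shows "\<exists>(Y :: (real ^ 'd) set) (\<alpha> :: real ^ 'd \<Rightarrow> real).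
           finite Y \<and> Y \<subseteq> cball 0 1 \<and>
           (\<forall>x \<in> cball 0 1.
              \<bar>f x - (\<Sum>y\<in>Y. \<alpha> y * polyharmonic_spline CARD('d) k (norm (x - y)))\<bar> \<le> \<epsilon>)"
proof -
  define s where "s = real k - real CARD('d) / 2"
  define \<alpha>0 :: real where "\<alpha>0 = (if odd CARD('d) then 1 else 0)"
  define \<beta>0 :: real where "\<beta>0 = (if odd CARD('d) then 0 else 1 / 2)"
  have "real CARD('d) < real (2 * k)" using assms(1) by simp
  then have dk: "CARD('d) < 2 * k" by (simp only: of_nat_less_iff)
  have par: "spline_parameters \<alpha>0 \<beta>0 s"
    unfolding s_def \<alpha>0_def \<beta>0_def using dk by (rule spline_parameters_polyharmonic)
  have "s + real DIM(real ^ 'd) / 2 = real k" by (simp add: s_def)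
  then have "kernel_approx (spline_kernel \<alpha>0 \<beta>0 s) (cball 0 1) (cball 0 1) f"
    using assms(2) par by (intro kernel_approx_cball)
  then obtain Y \<alpha> where Y: "finite Y" "Y \<subseteq> cball 0 1"
    "\<And>x. x \<in> cball 0 1 \<Longrightarrow> \<bar>f x - (\<Sum>y\<in>Y. \<alpha> y * spline_kernel \<alpha>0 \<beta>0 s x y)\<bar> \<le> \<epsilon>"
    by (rule kernel_approxE[OF _ assms(3)]) blast
  moreover have "spline_kernel \<alpha>0 \<beta>0 s x y = polyharmonic_spline CARD('d) k (norm (x - y))"
    for x y :: "real ^ 'd"
    unfolding spline_kernel_def \<alpha>0_def \<beta>0_def s_def
    using dk by (intro polyharmonic_spline_eq_profile[symmetric]) auto
  ultimately show ?thesis by (intro exI[of _ Y] exI[of _ \<alpha>]) simp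
qed

end
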